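(* In the notation of the context, for $0\le i,j\le D-1$ and $\mu,\nu\in\{+,-\}$, $$\langle\ell_i^\mu,\ell_j^\nu\rangle_{\mathfrak L}=\delta_{i,j}\delta_{\mu,\nu}\,N_i^\mu,\qquad N_i^-=q^{ie}\prod_{n=1}^i\frac{q^D-q^n}{q^n-1},\quad N_i^+=q^{(i+1)e}\prod_{n=1}^i\frac{q^D-q^n}{q^n-1}.$$
   Context: Let $q$ be a prime power, $D\ge3$ an integer, and $e\in\{0,\tfrac12,1,\tfrac32,2\}$ (with $q$ a square when $e\in\{\tfrac12,\tfrac32\}$); these are the parameters of a dual polar graph of diameter $D$ over $\mathbb F_q$ and $N_i^\pm$ are the sizes of certain vertex sets in it. Let $\tau=\sqrt{-1}\,q^{-(D+e)/2}$. Write $(r;q)_n=(1-r)(1-rq)\cdots(1-rq^{n-1})$ and ${}_3\phi_2\!\left(\begin{smallmatrix}r_1,r_2,r_3\\ s_1,s_2\end{smallmatrix};q,z\right)=\sum_{n\ge0}\frac{(r_1;q)_n(r_2;q)_n(r_3;q)_n}{(s_1;q)_n(s_2;q)_n}\frac{z^n}{(q;q)_n}$. For $t\ne0$ and $0\le i\le d$ let $h_i(\eta;t,d;q)=\frac{(q^{-d};q)_i}{t^i}\,{}_3\phi_2\!\left(\begin{smallmatrix}q^{-i},\,t\eta^{-1},\,t\eta\\ 0,\,q^{-d}\end{smallmatrix};q,q\right)$. Let $h_i=h_i(\eta;\tau,D;q)$, $h_i^\perp=h_i(\eta;\tau q,D-2;q)$ ($0\le i\le D-2$), $h^\perp_{-1}=0$,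 $h^\perp_{D-1}=\eta^{1-D}\prod_{n=1}^{D-1}(\eta-\tau q^n)(\eta-\tau^{-1}q^{-n})$, $p^\perp=\eta^{-1}(\eta-\tau)(\eta-\tau^{-1}q^{-D})$, and for $0\le i\le D-1$: $\ell_i^+=\frac{h_{i+1}-p^\perp h_i^\perp}{\tau^{i+1}(1-q^D)(q;q)_i}$, $\ell_i^-=\frac{q^D-q^i}{\tau^i(q^D-1)(q;q)_i}\big(h_i-\frac{1-q^i}{q^D-q^i}p^\perp h^\perp_{i-1}\big)$. These lie in $\mathfrak L=\operatorname{span}_{\mathbb C}\{\eta^k:-D\le k\le D-1\}$. Let $\lambda_i=\tau q^i$ ($0\le i\le D-1$), $\lambda_{-i}=\tau^{-1}q^{-i}$ ($1\le i\le D$). Let $w_0=1/(-q^e;q)_D$, $w_{-D}=1/(-q^{-e};q)_D$, and for $1\le i\le D-1$: $w_i=(-1)^iq^{i(D+e-i)}\frac{(q^{1-D};q)_i(1+q^D+q^{D+e-i}-q^{D-i})}{(q;q)_i(-q^{e-i};q)_D(1+q^{D+e-2i})}$, $w_{-i}=(-1)^{i-1}q^{i(D+e-i-2)+D+e}\frac{(q^{1-D};q)_{i-1}(1+q^D+q^{i-e}-q^i)}{(q;q)_{i-1}(-q^{e-i+1};q)_D(1+q^{D+e-2i})}$, $c_i=(-1)^iq^{i(D+e-i-1)+D}\frac{(q^{1-D};q)_i}{(q;q)_{i-1}(-q^{e-i+1};q)_{D-1}(1+q^{D+e-2i})}$. Define for $f,g\in\mathfrak L$: $\langle f,g\rangle_{\mathfrak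 L}=\sum_{i=-D}^{D-1}f(\lambda_i)\overline{g(\lambda_i)}\,w_i+\sum_{i=1}^{D-1}\big(f(\lambda_i)\overline{g(\lambda_{-i})}+f(\lambda_{-i})\overline{g(\lambda_i)}\big)c_i$. *)

theory Defs
  imports Complex_Main "HOL-Number_Theory.Prime_Powers"
begin

definition qp :: "real \<Rightarrow> real \<Rightarrow> complex" where
  "qp q x = complex_of_real (q powr x)"

definition qpoch :: "complex \<Rightarrow> complex \<Rightarrow> nat \<Rightarrow> complex" where
  "qpoch r Q n = (\<Prod>k<n. 1 - r * Q ^ k)"

definition tau :: "real \<Rightarrow> nat \<Rightarrow> real \<Rightarrow> complex" where
  "tau q D e = \<i> * qp q (- (real D + e) / 2)"

(* h_i(eta; t, d; q); the 3phi2 series terminates at n = i because of (q^{-i};q)_n *)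
definition hfun :: "real \<Rightarrow> complex \<Rightarrow> nat \<Rightarrow> nat \<Rightarrow> complex \<Rightarrow> complex" where
  "hfun q t d i eta =
     qpoch (qp q (- real d)) (of_real q) i / t ^ i *
     (\<Sum>n\<le>i. qpoch (qp q (- real i)) (of_real q) n * qpoch (t / eta) (of_real q) n
                * qpoch (t * eta) (of_real q) n
              / (qpoch 0 (of_real q) n * qpoch (qp q (- real d)) (of_real q) n)
              * (of_real q) ^ n / qpoch (of_real q) (of_real q) n)"

definition hh :: "real \<Rightarrow> nat \<Rightarrow> real \<Rightarrow> nat \<Rightarrow> complex \<Rightarrow> complex" where
  "hh q D e i eta = hfun q (tau q D e) D i eta"

definition hperp :: "real \<Rightarrow> nat \<Rightarrow> real \<Rightarrow> int \<Rightarrow> complex \<Rightarrow> complex" where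
  "hperp q D e i eta =
     (if i = -1 then 0
      else if i = int D - 1 then
        inverse (eta ^ (D - 1)) *
        (\<Prod>n\<in>{1..D-1}. (eta - tau q D e * qp q (real n))
                         * (eta - inverse (tau q D e) * qp q (- real n)))
      else hfun q (tau q D e * of_real q) (D - 2) (nat i) eta)"

definition pperp :: "real \<Rightarrow> nat \<Rightarrow> real \<Rightarrow> complex \<Rightarrow> complex" where
  "pperp q D e eta = inverse eta * (eta - tau q D e)
                     * (eta - inverse (tau q D e) * qp q (- real D))"

(* ell_i^+ (sign = True) and ell_i^- (sign = False) *)
definition ell :: "real \<Rightarrow> nat \<Rightarrow> real \<Rightarrow> bool \<Rightarrow> nat \<Rightarrow> complex \<Rightarrow> complex" where
  "ell q D e s i eta =
     (if s then
        (hh q D e (i + 1) eta - pperp q D e eta * hperp q D e (int i) eta)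
        / (tau q D e ^ (i + 1) * (1 - (of_real q) ^ D) * qpoch (of_real q) (of_real q) i)
      else
        ((of_real q) ^ D - (of_real q) ^ i)
        / (tau q D e ^ i * ((of_real q) ^ D - 1) * qpoch (of_real q) (of_real q) i)
        * (hh q D e i eta
           - (1 - (of_real q) ^ i) / ((of_real q) ^ D - (of_real q) ^ i)
             * pperp q D e eta * hperp q D e (int i - 1) eta))"

definition lam :: "real \<Rightarrow> nat \<Rightarrow> real \<Rightarrow> int \<Rightarrow> complex" where
  "lam q D e i = (if 0 \<le> i then tau q D e * qp q (real_of_int i)
                  else inverse (tau q D e) * qp q (real_of_int i))"

definition wt :: "real \<Rightarrow> nat \<Rightarrow> real \<Rightarrow> int \<Rightarrow> complex" where
  "wt q D e j =
     (let Q = complex_of_real q; Dr = real D in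
      if j = 0 then 1 / qpoch (- qp q e) Q D
      else if j = - int D then 1 / qpoch (- qp q (- e)) Q D
      else if j > 0 then
        (let i = nat j; ir = real i in
         (-1) ^ i * qp q (ir * (Dr + e - ir))
         * qpoch (qp q (1 - Dr)) Q i * (1 + Q ^ D + qp q (Dr + e - ir) - qp q (Dr - ir))
         / (qpoch Q Q i * qpoch (- qp q (e - ir)) Q D * (1 + qp q (Dr + e - 2 * ir))))
      else
        (let i = nat (- j); ir = real i in
         (-1) ^ (i - 1) * qp q (ir * (Dr + e - ir - 2) + Dr + e)
         * qpoch (qp q (1 - Dr)) Q (i - 1) * (1 + Q ^ D + qp q (ir - e) - Q ^ i)
         / (qpoch Q Q (i - 1) * qpoch (- qp q (e - ir + 1)) Q D
            * (1 + qp q (Dr + e - 2 * ir)))))"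

definition cwt :: "real \<Rightarrow> nat \<Rightarrow> real \<Rightarrow> nat \<Rightarrow> complex" where
  "cwt q D e i =
     (let Q = complex_of_real q; Dr = real D; ir = real i in
      (-1) ^ i * qp q (ir * (Dr + e - ir - 1) + Dr)
      * qpoch (qp q (1 - Dr)) Q i
      / (qpoch Q Q (i - 1) * qpoch (- qp q (e - ir + 1)) Q (D - 1)
         * (1 + qp q (Dr + e - 2 * ir))))"

definition ipL :: "real \<Rightarrow> nat \<Rightarrow> real \<Rightarrow> (complex \<Rightarrow> complex) \<Rightarrow> (complex \<Rightarrow> complex) \<Rightarrow> complex" where
  "ipL q D e f g =
     (\<Sum>i\<in>{- int D..int D - 1}. f (lam q D e i) * cnj (g (lam q D e i)) * wt q D e i)
   + (\<Sum>i\<in>{1..D-1}. (f (lam q D e (int i)) * cnj (g (lam q D e (- int i)))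
                     + f (lam q D e (- int i)) * cnj (g (lam q D e (int i)))) * cwt q D e i)"

(* N_i^+ (s = True), N_i^- (s = False) *)
definition NN :: "real \<Rightarrow> nat \<Rightarrow> real \<Rightarrow> bool \<Rightarrow> nat \<Rightarrow> complex" where
  "NN q D e s i =
     qp q ((if s then real i + 1 else real i) * e) *
     (\<Prod>n\<in>{1..i}. ((of_real q) ^ D - (of_real q) ^ n) / ((of_real q) ^ n - 1))"

end

theory Submission
  imports Defs
begin

text \<open>
  The nodes satisfy \<open>\<lambda>\<^sub>-\<^sub>k = 1 / \<lambda>\<^sub>k\<close>, and \<open>h\<^sub>i\<close>, \<open>h\<^sub>i\<^sup>\<bottom>\<close> are symmetric under inversion of
  \<open>\<eta>\<close>, so both depend only on \<open>|k|\<close> there: they are dual \<open>q\<close>-Krawtchouk polynomials on \<open>{0..D}\<close> and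
  \<open>{1..D-1}\<close>. Only \<open>p\<^sup>\<bottom>\<close> distinguishes \<open>\<lambda>\<^sub>k\<close> from \<open>\<lambda>\<^sub>-\<^sub>k\<close>, by two factors \<open>P\<^sub>+\<close>, \<open>P\<^sub>-\<close>, and it vanishes at
  \<open>\<lambda>\<^sub>0\<close> and \<open>\<lambda>\<^sub>-\<^sub>D\<close>. The weights are such that
  \<open>P\<^sub>+ (w\<^sub>k + c\<^sub>k) + P\<^sub>- (w\<^sub>-\<^sub>k + c\<^sub>k) = 0\<close>, which makes every \<open>h\<^sub>i\<close> orthogonal to every \<open>p\<^sup>\<bottom> h\<^sub>j\<^sup>\<bottom>\<close>, while
  \<open>w\<^sub>k + w\<^sub>-\<^sub>k + 2 c\<^sub>k\<close> and \<open>P\<^sub>+\<^sup>2 w\<^sub>k + P\<^sub>-\<^sup>2 w\<^sub>-\<^sub>k + 2 P\<^sub>+ P\<^sub>- c\<^sub>k\<close> are (multiples of) the two Krawtchouk weights.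
  So everything reduces to the norms of \<open>h\<^sub>i\<close> and \<open>p\<^sup>\<bottom> h\<^sub>i\<^sup>\<bottom>\<close>. The Krawtchouk orthogonality itself
  follows by summation by parts: the forward difference lowers the degree and maps parameters
  \<open>(T, N)\<close> to \<open>(T q, N - 1)\<close>, and its adjoint raises the degree.
\<close>

section \<open>Dual \<open>q\<close>-Krawtchouk polynomials\<close>

lemma qpoch_0 [simp]: "qpoch a q 0 = 1"
  by (simp add: qpoch_def)

lemma qpoch_Suc: "qpoch a q (Suc n) = qpoch a q n * (1 - a * q ^ n)"
  by (simp add: qpoch_def)

lemma qpoch_Suc_shift: "qpoch a q (Suc n) = (1 - a) * qpoch (a * q) q n"
  unfolding qpoch_def by (subst prod.lessThan_Suc_shift) (simp add: ac_simps)

lemma qpoch_shift: "(1 - a) * qpoch (a * q) q n = qpoch a q n * (1 - a * q ^ n)"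
  by (metis qpoch_Suc qpoch_Suc_shift)

lemma qpoch_zero_left [simp]: "qpoch 0 q n = 1"
  by (simp add: qpoch_def)

lemma qpoch_eq_0_iff: "qpoch a q n = 0 \<longleftrightarrow> (\<exists>k<n. a * q ^ k = 1)"
  by (auto simp: qpoch_def)

text \<open>As a function of \<open>x\<close> this is a polynomial of degree \<open>m\<close> in
  \<open>1 / q ^ x + T * q ^ x\<close>: the \<open>k\<close>-th factors multiply to
  \<open>1 - q ^ k * (1 / q ^ x + T * q ^ x) + T * q ^ (2 * k)\<close>.\<close>

definition qk_basis :: "complex \<Rightarrow> complex \<Rightarrow> nat \<Rightarrow> nat \<Rightarrow> complex" where
  "qk_basis q T m x = qpoch (1 / q ^ x) q m * qpoch (T * q ^ x) q m"

definition qk_coeff :: "complex \<Rightarrow> nat \<Rightarrow> nat \<Rightarrow> nat \<Rightarrow> complex" where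
  "qk_coeff q N n m = qpoch (1 / q ^ n) q m * q ^ m / (qpoch (1 / q ^ N) q m * qpoch q q m)"

text \<open>The dual q-Krawtchouk polynomial as a 3phi2 series with lower parameters
  \<open>0\<close> and \<open>1 / q ^ N\<close>, stopped at \<open>n\<close> because
  \<open>qk_coeff\<close> vanishes beyond it.\<close>

definition qk :: "complex \<Rightarrow> complex \<Rightarrow> nat \<Rightarrow> nat \<Rightarrow> nat \<Rightarrow> complex" where
  "qk q T N n x = (\<Sum>m\<le>n. qk_coeff q N n m * qk_basis q T m x)"

text \<open>
  In the usual notation \<open>T = c q\<^sup>-\<^sup>N\<close>. Multiplying by \<open>q ^ (x * x)\<close> in the denominator instead of using the
  standard factor \<open>c\<^sup>-\<^sup>x q\<^sup>x\<^sup>(\<^sup>2\<^sup>N\<^sup>-\<^sup>x\<^sup>)\<close> keeps all exponents in \<open>\<nat>\<close>.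
\<close>

definition qk_weight :: "complex \<Rightarrow> complex \<Rightarrow> nat \<Rightarrow> nat \<Rightarrow> complex" where
  "qk_weight q T N x =
     qpoch T q x * qpoch (1 / q ^ N) q x * (1 - T * q ^ (2 * x)) * (q ^ N / T) ^ x
     / ((1 - T) * qpoch q q x * qpoch (T * q ^ Suc N) q x * q ^ (x * x))"

text \<open>Boundary term of the summation by parts from \<open>N + 1\<close> to \<open>N\<close>.\<close>

definition qk_bdry :: "complex \<Rightarrow> complex \<Rightarrow> nat \<Rightarrow> nat \<Rightarrow> complex" where
  "qk_bdry q T N x =
     (1 - T * q) * qk_weight q (T * q) N x * q ^ x / (1 - T * q ^ Suc (2 * x))"

text \<open>These conditions keep the denominators of the weights nonzero, and they survive the
  passage from \<open>T\<close> to \<open>T * q ^ k\<close>, so an induction may change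
  \<open>T\<close>.\<close>

locale qk_generic =
  fixes q T :: complex
  assumes q_nz: "q \<noteq> 0" and T_nz: "T \<noteq> 0"
    and q_pow: "\<And>n. 0 < n \<Longrightarrow> q ^ n \<noteq> 1"
    and T_pow: "\<And>n. T * q ^ n \<noteq> 1"
begin

lemma shift: "qk_generic q (T * q ^ k)"
  using q_nz T_nz q_pow T_pow by unfold_locales (auto simp: mult.assoc simp flip: power_add)

lemma T_ne_1: "T \<noteq> 1"
  using T_pow[of 0] by simp

lemma one_minus_T: "1 - T * q ^ n \<noteq> 0"
  using T_pow[of n] by simp

lemma pow_inj: "q ^ m = q ^ n \<longleftrightarrow> m = n"
proof (induction m n rule: linorder_wlog)
  case (le m n)
  have "q ^ n = q ^ m * q ^ (n - m)"
    using le by (simp flip: power_add)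
  then show ?case
    using q_nz q_pow[of "n - m"] le by (cases "m = n") auto
qed auto

lemma qpoch_q_nz: "qpoch q q n \<noteq> 0"
  using q_pow by (auto simp: qpoch_eq_0_iff simp flip: power_Suc)

lemma qpoch_T_nz: "qpoch (T * q ^ k) q n \<noteq> 0"
  using T_pow by (auto simp: qpoch_eq_0_iff mult.assoc simp flip: power_add)

lemma qpoch_inverse_pow_nz: "n \<le> N \<Longrightarrow> qpoch (1 / q ^ N) q n \<noteq> 0"
  using pow_inj q_nz by (auto simp: qpoch_eq_0_iff field_simps)

lemma qpoch_inverse_pow_0: "N < n \<Longrightarrow> qpoch (1 / q ^ N) q n = 0"
  using q_nz by (auto simp: qpoch_eq_0_iff intro!: exI[of _ N])

section \<open>The forward shift, which lowers the degree\<close>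

lemma qk_coeff_Suc_Suc:
  assumes "n \<le> N"
  shows "qk_coeff q (Suc N) (Suc n) (Suc m) * (q ^ Suc m - 1) / q
         = - (1 - 1 / q ^ Suc n) / (1 - 1 / q ^ Suc N) * qk_coeff q N n m"
proof -
  have 1: "1 / q ^ Suc k * q = 1 / q ^ k" for k
    using q_nz by simp
  have 2: "qpoch (1 / q ^ Suc k) q (Suc m) = (1 - 1 / q ^ Suc k) * qpoch (1 / q ^ k) q m" for k
    by (simp only: qpoch_Suc_shift 1)
  have 3: "qpoch q q (Suc m) = qpoch q q m * (1 - q ^ Suc m)"
    by (simp add: qpoch_Suc)
  define u v where "u = 1 - 1 / q ^ Suc n" and "v = 1 - 1 / q ^ Suc N"
  define w where "w = 1 - q ^ Suc m"
  have "q ^ Suc m - 1 = - w" "w \<noteq> 0"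
    using q_pow[of "Suc m"] by (simp_all add: w_def)
  then show ?thesis
    unfolding qk_coeff_def 2 3 u_def[symmetric] v_def[symmetric] w_def[symmetric]
    using q_nz by simp
qed

text \<open>Both terms contain the factor \<open>qk_basis q (T * q) m x\<close>; what is left is a
  difference of products of two end factors, and it factorises.\<close>

lemma qk_basis_diff:
  "qk_basis q T (Suc m) (Suc x) - qk_basis q T (Suc m) x
   = (q ^ Suc m - 1) / q * ((1 - T * q ^ Suc (2 * x)) / q ^ x * qk_basis q (T * q) m x)"
proof -
  have 1: "qpoch (1 / q ^ Suc x) q (Suc m) = (1 - 1 / q ^ Suc x) * qpoch (1 / q ^ x) q m"
    using q_nz by (simp add: qpoch_Suc_shift)
  have 2: "qpoch (T * q ^ x) q (Suc m) = (1 - T * q ^ x) * qpoch (T * q * q ^ x) q m"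
    by (simp add: qpoch_Suc_shift ac_simps)
  have 3: "qpoch (1 / q ^ x) q (Suc m) = (1 - q ^ m / q ^ x) * qpoch (1 / q ^ x) q m"
    by (simp add: qpoch_Suc)
  have 4: "qpoch (T * q ^ Suc x) q (Suc m) = (1 - T * q ^ Suc x * q ^ m) * qpoch (T * q * q ^ x) q m"
    by (simp add: qpoch_Suc ac_simps)
  have 5: "q ^ Suc (2 * x) = q * q ^ x * q ^ x"
    by (simp add: mult_2 power_add)
  define A B X M where "A = qpoch (1 / q ^ x) q m" and "B = qpoch (T * q * q ^ x) q m"
    and "X = q ^ x" and "M = q ^ m"
  have nz: "X \<noteq> 0" using q_nz by (simp add: X_def)
  show ?thesis
    unfolding qk_basis_def 1 2 3 4 5
    unfolding power_Suc A_def[symmetric] B_def[symmetric] X_def[symmetric] M_def[symmetric]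
    using nz q_nz by (simp add: divide_simps) (simp add: algebra_simps)
qed

lemma qk_forward_shift:
  assumes "n \<le> N"
  shows "qk q T (Suc N) (Suc n) (Suc x) - qk q T (Suc N) (Suc n) x
         = - (1 - 1 / q ^ Suc n) / (1 - 1 / q ^ Suc N) * ((1 - T * q ^ Suc (2 * x)) / q ^ x) * qk q (T * q) N n x"
proof -
  have "qk q T (Suc N) (Suc n) (Suc x) - qk q T (Suc N) (Suc n) x
     = (\<Sum>m\<le>Suc n. qk_coeff q (Suc N) (Suc n) m * (qk_basis q T m (Suc x) - qk_basis q T m x))"
    unfolding qk_def by (simp only: right_diff_distrib sum_subtractf)
  \<comment> \<open>The basis function of index 0 is constant in \<open>x\<close>, so its difference
    drops out and the index can be shifted.\<close>
  also have "\<dots> = (\<Sum>m\<le>n. qk_coeff q (Suc N) (Suc n) (Suc m)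
                   * (qk_basis q T (Suc m) (Suc x) - qk_basis q T (Suc m) x))"
    by (subst sum.atMost_Suc_shift) (simp add: qk_basis_def)
  also have "\<dots> = (\<Sum>m\<le>n. - (1 - 1 / q ^ Suc n) / (1 - 1 / q ^ Suc N) * ((1 - T * q ^ Suc (2 * x)) / q ^ x)
                   * (qk_coeff q N n m * qk_basis q (T * q) m x))"
  proof (rule sum.cong[OF refl])
    fix m
    show "qk_coeff q (Suc N) (Suc n) (Suc m) * (qk_basis q T (Suc m) (Suc x) - qk_basis q T (Suc m) x)
      = - (1 - 1 / q ^ Suc n) / (1 - 1 / q ^ Suc N) * ((1 - T * q ^ Suc (2 * x)) / q ^ x)
                   * (qk_coeff q N n m * qk_basis q (T * q) m x)"
      unfolding qk_basis_diff
      using arg_cong[OF qk_coeff_Suc_Suc[OF assms, of m],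
          of "\<lambda>u. u * ((1 - T * q ^ Suc (2 * x)) / q ^ x * qk_basis q (T * q) m x)"]
      by (simp only: mult_ac times_divide_eq_left times_divide_eq_right divide_divide_eq_left)
  qed
  finally show ?thesis
    by (simp only: qk_def sum_distrib_left)
qed

section \<open>The backward shift, the adjoint that raises the degree\<close>

lemma qk_bdry_upper:
  "qk_bdry q T N x
   = qk_weight q T (Suc N) x * ((1 - T * q ^ x) * (1 - q ^ x / q ^ Suc N)
       / (q ^ x * (1 - 1 / q ^ Suc N) * (1 - T * q ^ (2 * x))))"
proof -
  have 1: "(1 - T) * qpoch (T * q) q x = qpoch T q x * (1 - T * q ^ x)"
    by (rule qpoch_shift)
  have 2: "(1 - 1 / q ^ Suc N) * qpoch (1 / q ^ N) q x = qpoch (1 / q ^ Suc N) q x * (1 - q ^ x / q ^ Suc N)"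
    using qpoch_shift[of "1 / q ^ Suc N" q x] q_nz by simp
  have nz: "1 - T \<noteq> 0" "1 - T * q \<noteq> 0" "1 - T * q ^ Suc (2 * x) \<noteq> 0" "1 - T * q ^ (2 * x) \<noteq> 0"
    using T_pow[of 0] T_pow[of 1] T_pow[of "Suc (2 * x)"] T_pow[of "2 * x"] by auto
  have nz2: "1 - 1 / q ^ Suc N \<noteq> 0"
    using q_pow[of "Suc N"] q_nz by (auto simp: field_simps)
  have nz3: "qpoch (T * q ^ Suc (Suc N)) q x \<noteq> 0" "qpoch q q x \<noteq> 0"
    using qpoch_T_nz[of "Suc (Suc N)"] qpoch_q_nz by auto
  have e: "(q ^ N / (T * q)) ^ x * q ^ x * q ^ x = (q ^ Suc N / T) ^ x"
    using q_nz T_nz by (simp add: power_divide power_mult_distrib)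
  have s: "T * q * q ^ Suc N = T * q ^ Suc (Suc N)" "T * q * q ^ (2 * x) = T * q ^ Suc (2 * x)"
    by simp_all
  have A: "qpoch (T * q) q x = qpoch T q x * (1 - T * q ^ x) / (1 - T)"
    using 1 nz by (simp add: field_simps)
  have B: "qpoch (1 / q ^ N) q x = qpoch (1 / q ^ Suc N) q x * (1 - q ^ x / q ^ Suc N) / (1 - 1 / q ^ Suc N)"
    using 2 nz2 by (metis nonzero_eq_divide_eq mult.commute)
  define c d P R where "c = 1 - q ^ x / q ^ Suc N" and "d = 1 - 1 / q ^ Suc N"
    and "P = qpoch (1 / q ^ Suc N) q x" and "R = qpoch (T * q ^ Suc (Suc N)) q x"
  show ?thesis
    unfolding qk_bdry_def qk_weight_def s A B e[symmetric]
    unfolding c_def[symmetric] d_def[symmetric] P_def[symmetric] R_def[symmetric]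
    using nz nz2[folded d_def] nz3[folded R_def] q_nz
    by (simp add: divide_simps del: power_Suc)
qed

text \<open>Together with \<open>qk_bdry_upper\<close> this compares a boundary value with the
  weight for \<open>(T, Suc N)\<close> at both ends of the step from \<open>x\<close> to
  \<open>Suc x\<close>. Hence the two boundary values next to a point are both multiples of the
  weight there.\<close>

lemma qk_bdry_lower:
  "qk_bdry q T N x
   = qk_weight q T (Suc N) (Suc x) * (T * q ^ Suc x / q ^ Suc N * (1 - q ^ Suc x) * (1 - T * q ^ (Suc N + Suc x))
       / ((1 - 1 / q ^ Suc N) * (1 - T * q ^ (2 * Suc x))))"
proof -
  have 1: "qpoch T q (Suc x) = (1 - T) * qpoch (T * q) q x"
    by (rule qpoch_Suc_shift)
  have 2: "qpoch (1 / q ^ Suc N) q (Suc x) = (1 - 1 / q ^ Suc N) * qpoch (1 / q ^ N) q x"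
    using q_nz by (simp add: qpoch_Suc_shift)
  have 3: "qpoch q q (Suc x) = qpoch q q x * (1 - q ^ Suc x)"
          "qpoch (T * q ^ Suc (Suc N)) q (Suc x)
            = qpoch (T * q ^ Suc (Suc N)) q x * (1 - T * q ^ (Suc N + Suc x))"
    by (simp_all add: qpoch_Suc power_add ac_simps)
  have nz: "1 - T \<noteq> 0" "1 - T * q \<noteq> 0" "1 - T * q ^ Suc (2 * x) \<noteq> 0" "1 - T * q ^ (2 * Suc x) \<noteq> 0"
      "1 - T * q ^ (Suc N + Suc x) \<noteq> 0" "1 - q ^ Suc x \<noteq> 0"
    using T_pow[of 0] T_pow[of 1] T_pow[of "Suc (2 * x)"] T_pow[of "2 * Suc x"] T_pow[of "Suc N + Suc x"]
      q_pow[of "Suc x"] by auto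
  have nz2: "1 - 1 / q ^ Suc N \<noteq> 0"
    using q_pow[of "Suc N"] q_nz by (auto simp: field_simps)
  have nz3: "qpoch (T * q ^ Suc (Suc N)) q x \<noteq> 0" "qpoch q q x \<noteq> 0"
    using qpoch_T_nz[of "Suc (Suc N)"] qpoch_q_nz by auto
  have s: "T * q * q ^ Suc N = T * q ^ Suc (Suc N)" "T * q * q ^ (2 * x) = T * q ^ Suc (2 * x)"
    by simp_all
  have e: "(q ^ Suc N / T) ^ Suc x = (q ^ N / (T * q)) ^ x * q ^ x * q ^ x * (q ^ Suc N / T)"
    using q_nz T_nz by (simp add: power_divide power_mult_distrib ac_simps)
  have f: "q ^ (Suc x * Suc x) = q ^ (x * x) * q ^ x * q ^ x * q"
    by (simp flip: power_add power_Suc) (simp add: algebra_simps)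
  define d P R g where "d = 1 - 1 / q ^ Suc N"
    and "P = qpoch (1 / q ^ N) q x" and "R = qpoch (T * q ^ Suc (Suc N)) q x"
    and "g = q ^ (x * x)"
  have "g \<noteq> 0" using q_nz by (simp add: g_def)
  define y where "y = 1 - T * q ^ (Suc N + Suc x)"
  define z where "z = 1 - T * q ^ (2 * Suc x)"
  define w where "w = 1 - T * q ^ Suc (2 * x)"
  define u where "u = 1 - q ^ Suc x"
  define G where "G = (q ^ N / (T * q)) ^ x"
  define B where "B = q ^ Suc N"
  have "B \<noteq> 0" using q_nz by (simp add: B_def)
  have Xs: "q ^ Suc x = q * q ^ x" by simp
  define X where "X = q ^ x"
  have "X \<noteq> 0" using q_nz by (simp add: X_def)
  show ?thesis
    unfolding qk_bdry_def qk_weight_def s 1 2 3 e f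
    unfolding d_def[symmetric] P_def[symmetric] R_def[symmetric] g_def[symmetric]
      y_def[symmetric] z_def[symmetric] w_def[symmetric] u_def[symmetric] G_def[symmetric]
    unfolding B_def[symmetric] Xs X_def[symmetric]
    using nz[folded y_def z_def u_def w_def] nz2[folded d_def] nz3[folded R_def] q_nz T_nz
      \<open>g \<noteq> 0\<close> \<open>B \<noteq> 0\<close> \<open>X \<noteq> 0\<close>
    by (simp add: field_simps)
qed

text \<open>The weight and \<open>qk_basis q T m x\<close> factor out of both boundary terms, which
  leaves the rational identity \<open>key\<close> in \<open>q ^ x\<close>, \<open>q ^ m\<close> and
  \<open>q ^ Suc N\<close>. The value 0 at \<open>x = 0\<close> stands for the missing left
  neighbour.\<close>

lemma qk_basis_backward_shift:
  "(case x of 0 \<Rightarrow> 0 | Suc y \<Rightarrow> qk_bdry q T N y * qk_basis q (T * q) m y) - qk_bdry q T N x * qk_basis q (T * q) m x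
   = qk_weight q T (Suc N) x / (1 - 1 / q ^ Suc N)
     * ((1 / q ^ Suc N - 1 / q ^ m) * qk_basis q T m x + 1 / q ^ m * qk_basis q T (Suc m) x)"
proof -
  have 1: "(1 - T * q ^ x) * qk_basis q (T * q) m x = (1 - T * q ^ x * q ^ m) * qk_basis q T m x"
    using qpoch_shift[of "T * q ^ x" q m] by (simp add: qk_basis_def ac_simps)
  have 2: "(case x of 0 \<Rightarrow> 0 | Suc y \<Rightarrow> qk_bdry q T N y * qk_basis q (T * q) m y)
      = qk_weight q T (Suc N) x * (T * q ^ x / q ^ Suc N * (1 - T * q ^ (Suc N + x))
         * (- (q ^ x) * (1 - q ^ m / q ^ x) * qk_basis q T m x)
       / ((1 - 1 / q ^ Suc N) * (1 - T * q ^ (2 * x))))"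
  proof (cases x)
    \<comment> \<open>The right-hand side vanishes as well: \<open>1 - q ^ m\<close> is zero for
      \<open>m = 0\<close>, and \<open>qk_basis q T m 0\<close> is zero otherwise.\<close>
    case 0
    then show ?thesis
      by (cases m) (simp_all add: qk_basis_def qpoch_Suc_shift)
  next
    case (Suc y)
    have "(1 - 1 / q ^ x) * qpoch (1 / q ^ y) q m = qpoch (1 / q ^ x) q m * (1 - q ^ m / q ^ x)"
      using qpoch_shift[of "1 / q ^ x" q m] q_nz by (simp add: Suc)
    then have "- (q ^ x) * ((1 - q ^ m / q ^ x) * qk_basis q T m x)
        = - (q ^ x) * ((1 - 1 / q ^ x) * qk_basis q (T * q) m y)"
      by (simp add: qk_basis_def Suc ac_simps)
    also have "\<dots> = (1 - q ^ x) * qk_basis q (T * q) m y"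
      using q_nz by (simp add: algebra_simps)
    finally have "- (q ^ x) * (1 - q ^ m / q ^ x) * qk_basis q T m x = (1 - q ^ x) * qk_basis q (T * q) m y"
      by (simp only: mult.assoc)
    then show ?thesis
      by (simp add: Suc qk_bdry_lower del: power_Suc)
  qed
  have 3: "qk_bdry q T N x * qk_basis q (T * q) m x
      = qk_weight q T (Suc N) x * ((1 - q ^ x / q ^ Suc N) * ((1 - T * q ^ x * q ^ m) * qk_basis q T m x)
       / (q ^ x * (1 - 1 / q ^ Suc N) * (1 - T * q ^ (2 * x))))"
    unfolding qk_bdry_upper 1[symmetric] by (simp del: power_Suc)
  have 4: "qk_basis q T (Suc m) x = qk_basis q T m x * ((1 - q ^ m / q ^ x) * (1 - T * q ^ x * q ^ m))"
    by (simp add: qk_basis_def qpoch_Suc)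
  have nz: "1 - T * q ^ (2 * x) \<noteq> 0" by (rule one_minus_T)
  have 5: "1 - 1 / q ^ Suc N \<noteq> 0"
    using q_pow[of "Suc N"] q_nz by (auto simp: field_simps)
  have sq: "q ^ (2 * x) = q ^ x * q ^ x" by (simp add: mult_2 power_add)
  have sp: "q ^ (Suc N + x) = q ^ Suc N * q ^ x" by (simp add: power_add)
  define X A B where "X = q ^ x" and "A = q ^ m" and "B = q ^ Suc N"
  define W F d where "W = qk_weight q T (Suc N) x" and "F = qk_basis q T m x" and "d = 1 - 1 / B"
  have nz': "X \<noteq> 0" "A \<noteq> 0" "B \<noteq> 0" "d \<noteq> 0" "1 - T * (X * X) \<noteq> 0"
    using q_nz 5 nz by (simp_all add: X_def A_def B_def d_def sq)
  have key: "T * X / B * (1 - T * (B * X)) * (- X * (1 - A / X))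
        - (1 - X / B) * (1 - T * X * A) / X
      = (1 - T * (X * X)) * ((1 / B - 1 / A) + 1 / A * ((1 - A / X) * (1 - T * X * A)))"
    using nz' by (simp add: divide_simps) (simp add: algebra_simps)
  have comm: "W * (a * (b * F) / (d * z)) - W * (c * (g * F) / (X * d * z)) = W / d * F / z * (a * b - c * g / X)"
    if "z \<noteq> 0" for a b c g z
    using nz'(1,4) that by (simp add: divide_simps) (simp add: algebra_simps)
  have canc: "W / d * F / z * (z * (a + b * c)) = W / d * (a * F + b * (F * c))" if "z \<noteq> 0" for a b c z
    using that by (simp add: algebra_simps)
  have "W * (T * X / B * (1 - T * (B * X)) * (- X * (1 - A / X) * F) / (d * (1 - T * (X * X))))
      - W * ((1 - X / B) * ((1 - T * X * A) * F) / (X * d * (1 - T * (X * X))))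
      = W / d * F / (1 - T * (X * X)) * (T * X / B * (1 - T * (B * X)) * (- X * (1 - A / X))
        - (1 - X / B) * (1 - T * X * A) / X)"
    by (rule comm[OF nz'(5)])
  also have "\<dots> = W / d * ((1 / B - 1 / A) * F + 1 / A * (F * ((1 - A / X) * (1 - T * X * A))))"
    unfolding key by (rule canc[OF nz'(5)])
  finally show ?thesis
    unfolding 2 3 4 sq sp
    unfolding X_def[symmetric] A_def[symmetric] B_def[symmetric] W_def[symmetric] F_def[symmetric] d_def[symmetric] .
qed

text \<open>This compares the coefficients of the basis function of index \<open>Suc m\<close> after
  a termwise application of \<open>qk_basis_backward_shift\<close>.\<close>

lemma qk_coeff_backward:
  assumes "n \<le> N" "m \<le> n"
  shows "qk_coeff q (Suc N) (Suc n) (Suc m)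
     = - (1 / (1 - 1 / q ^ Suc N)) * (qk_coeff q N n (Suc m) * (1 / q ^ Suc N - 1 / q ^ Suc m) + qk_coeff q N n m / q ^ m)"
proof -
  have 1: "1 / q ^ Suc k * q = 1 / q ^ k" for k
    using q_nz by simp
  have 2: "qpoch (1 / q ^ Suc k) q (Suc m) = (1 - 1 / q ^ Suc k) * qpoch (1 / q ^ k) q m" for k
    by (simp only: qpoch_Suc_shift 1)
  have 3: "qpoch (1 / q ^ k) q (Suc m) = qpoch (1 / q ^ k) q m * (1 - q ^ m / q ^ k)" for k
    by (simp add: qpoch_Suc)
  have 4: "qpoch q q (Suc m) = qpoch q q m * (1 - q ^ Suc m)"
    by (simp add: qpoch_Suc)
  have nz: "1 - q ^ Suc m \<noteq> 0" "1 - 1 / q ^ Suc N \<noteq> 0"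
    using q_pow[of "Suc m"] q_pow[of "Suc N"] q_nz by (simp_all add: field_simps)
  have nz2: "qpoch q q m \<noteq> 0" "qpoch (1 / q ^ N) q m \<noteq> 0"
    using qpoch_q_nz qpoch_inverse_pow_nz assms by simp_all
  define P R S A B C where "P = qpoch (1 / q ^ n) q m" and "R = qpoch (1 / q ^ N) q m" and "S = qpoch q q m"
     and "A = q ^ m" and "B = q ^ N" and "C = q ^ n"
  have nz3: "A \<noteq> 0" "B \<noteq> 0" "C \<noteq> 0" using q_nz by (simp_all add: A_def B_def C_def)
  show ?thesis
  \<comment> \<open>For \<open>m = n\<close> the numerator
    \<open>qpoch (1 / q ^ n) q (Suc n)\<close> is zero. If moreover \<open>n = N\<close>, the
    denominator is zero too, and the quotient still has the right value 0.\<close>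
  proof (cases "m = n")
    case True
    show ?thesis
      unfolding qk_coeff_def 2 3[of n] 3[of N] 4
      unfolding P_def[symmetric] R_def[symmetric] S_def[symmetric] A_def[symmetric] B_def[symmetric] C_def[symmetric] power_Suc
      using nz[unfolded power_Suc A_def[symmetric] B_def[symmetric]] nz2[folded R_def S_def] nz3 q_nz
        True[THEN arg_cong, of "\<lambda>m. q ^ m", folded A_def C_def]
      by (simp add: divide_simps) (simp add: algebra_simps)
  next
    case False
    then have "1 - q ^ m / q ^ N \<noteq> 0"
      using assms pow_inj[of m N] q_nz by (auto simp: field_simps)
    then show ?thesis
      unfolding qk_coeff_def 2 3[of n] 3[of N] 4
      unfolding P_def[symmetric] R_def[symmetric] S_def[symmetric] A_def[symmetric] B_def[symmetric] C_def[symmetric] power_Suc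
      using nz[unfolded power_Suc A_def[symmetric] B_def[symmetric]] nz2[folded R_def S_def] nz3 q_nz
      by (simp add: divide_simps) (simp add: algebra_simps)
  qed
qed

lemma qk_backward_shift:
  assumes "n \<le> N"
  shows "qk_weight q T (Suc N) x * qk q T (Suc N) (Suc n) x
    = qk_bdry q T N x * qk q (T * q) N n x
      - (case x of 0 \<Rightarrow> 0 | Suc y \<Rightarrow> qk_bdry q T N y * qk q (T * q) N n y)"
proof -
  define k where "k = 1 - 1 / q ^ Suc N"
  have k: "k \<noteq> 0"
    using q_pow[of "Suc N"] q_nz by (auto simp: k_def field_simps)
  define a where "a = qk_coeff q N n"
  define F where "F m = qk_basis q T m x" for m
  define W where "W = qk_weight q T (Suc N) x"
  have a_top: "a (Suc n) = 0"
    using qpoch_inverse_pow_0[of n "Suc n"] by (simp add: a_def qk_coeff_def)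
  have "(case x of 0 \<Rightarrow> 0 | Suc y \<Rightarrow> qk_bdry q T N y * qk q (T * q) N n y) - qk_bdry q T N x * qk q (T * q) N n x
     = (\<Sum>m\<le>n. a m * ((case x of 0 \<Rightarrow> 0 | Suc y \<Rightarrow> qk_bdry q T N y * qk_basis q (T * q) m y)
                - qk_bdry q T N x * qk_basis q (T * q) m x))"
    by (cases x) (simp_all add: qk_def a_def sum_distrib_left right_diff_distrib sum_subtractf sum_negf ac_simps)
  also have "\<dots> = (\<Sum>m\<le>n. a m * (W / k * ((1 / q ^ Suc N - 1 / q ^ m) * F m + 1 / q ^ m * F (Suc m))))"
    unfolding qk_basis_backward_shift F_def W_def k_def ..
  also have "\<dots> = W / k * ((\<Sum>m\<le>n. a m * (1 / q ^ Suc N - 1 / q ^ m) * F m) + (\<Sum>m\<le>n. a m / q ^ m * F (Suc m)))"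
    by (simp add: sum_distrib_left distrib_left sum.distrib mult_ac)
  \<comment> \<open>Since \<open>a (Suc n)\<close> vanishes, the sum may run to
    \<open>Suc n\<close>; without its first term it then lines up with the shifted sum.\<close>
  also have "(\<Sum>m\<le>n. a m * (1 / q ^ Suc N - 1 / q ^ m) * F m)
      = (\<Sum>m\<le>Suc n. a m * (1 / q ^ Suc N - 1 / q ^ m) * F m)"
    using a_top by simp
  also have "\<dots> = a 0 * (1 / q ^ Suc N - 1) * F 0 + (\<Sum>m\<le>n. a (Suc m) * (1 / q ^ Suc N - 1 / q ^ Suc m) * F (Suc m))"
    by (subst sum.atMost_Suc_shift) simp
  also have "\<dots> + (\<Sum>m\<le>n. a m / q ^ m * F (Suc m)) = - k * F 0 +
     (\<Sum>m\<le>n. (a (Suc m) * (1 / q ^ Suc N - 1 / q ^ Suc m) + a m / q ^ m) * F (Suc m))"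
    by (simp add: a_def qk_coeff_def k_def distrib_right sum.distrib add.assoc)
  also have "(\<Sum>m\<le>n. (a (Suc m) * (1 / q ^ Suc N - 1 / q ^ Suc m) + a m / q ^ m) * F (Suc m))
     = (\<Sum>m\<le>n. - k * (qk_coeff q (Suc N) (Suc n) (Suc m) * F (Suc m)))"
  proof (rule sum.cong[OF refl])
    fix m assume "m \<in> {..n}"
    then have "qk_coeff q (Suc N) (Suc n) (Suc m)
     = - (1 / k) * (a (Suc m) * (1 / q ^ Suc N - 1 / q ^ Suc m) + a m / q ^ m)"
      unfolding a_def k_def using assms by (intro qk_coeff_backward) auto
    then show "(a (Suc m) * (1 / q ^ Suc N - 1 / q ^ Suc m) + a m / q ^ m) * F (Suc m)
        = - k * (qk_coeff q (Suc N) (Suc n) (Suc m) * F (Suc m))"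
      using k by simp
  qed
  also have "- k * F 0 + (\<Sum>m\<le>n. - k * (qk_coeff q (Suc N) (Suc n) (Suc m) * F (Suc m)))
     = - k * (\<Sum>m\<le>Suc n. qk_coeff q (Suc N) (Suc n) m * F m)"
    by (subst sum.atMost_Suc_shift) (simp add: qk_coeff_def sum_distrib_left distrib_left)
  finally have "(case x of 0 \<Rightarrow> 0 | Suc y \<Rightarrow> qk_bdry q T N y * qk q (T * q) N n y) - qk_bdry q T N x * qk q (T * q) N n x
     = - (W * qk q T (Suc N) (Suc n) x)"
    using k by (simp add: F_def qk_def del: sum.atMost_Suc)
  then show ?thesis
    unfolding W_def by (metis minus_diff_eq minus_minus)
qed

section \<open>Summation by parts and reduction of inner products\<close>

lemma qk_sum_by_parts:
  assumes "n \<le> N"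
  shows "(\<Sum>x\<le>Suc N. qk_weight q T (Suc N) x * qk q T (Suc N) (Suc n) x * f x)
    = - (\<Sum>x\<le>N. qk_bdry q T N x * qk q (T * q) N n x * (f (Suc x) - f x))"
proof -
  define d where "d x = qk_bdry q T N x * qk q (T * q) N n x" for x
  \<comment> \<open>\<open>qpoch (1 / q ^ N) q (Suc N)\<close> contains a zero factor, so nothing
    survives at the upper end.\<close>
  have "d (Suc N) = 0"
    by (simp add: d_def qk_bdry_def qk_weight_def qpoch_inverse_pow_0)
  have "(\<Sum>x\<le>Suc N. qk_weight q T (Suc N) x * qk q T (Suc N) (Suc n) x * f x)
      = (\<Sum>x\<le>Suc N. d x * f x) - (\<Sum>x\<le>Suc N. (case x of 0 \<Rightarrow> 0 | Suc y \<Rightarrow> d y) * f x)"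
    by (simp only: qk_backward_shift[OF assms] d_def left_diff_distrib sum_subtractf)
  also have "(\<Sum>x\<le>Suc N. (case x of 0 \<Rightarrow> 0 | Suc y \<Rightarrow> d y) * f x) = (\<Sum>x\<le>N. d x * f (Suc x))"
    by (subst sum.atMost_Suc_shift) simp
  also have "(\<Sum>x\<le>Suc N. d x * f x) = (\<Sum>x\<le>N. d x * f x)"
    using \<open>d (Suc N) = 0\<close> by simp
  finally show ?thesis
    by (simp add: d_def right_diff_distrib sum_subtractf)
qed

lemma qk_ip_Suc_0:
  "n \<le> N \<Longrightarrow> (\<Sum>x\<le>Suc N. qk_weight q T (Suc N) x * qk q T (Suc N) (Suc n) x) = 0"
  using qk_sum_by_parts[of n N "\<lambda>_. 1"] by simp

text \<open>Summation by parts puts a difference on the second polynomial, and the forward shift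
  lowers its degree. The factor \<open>(1 - T * q ^ Suc (2 * x)) / q ^ x\<close> this produces
  cancels in \<open>qk_bdry\<close> and leaves the weight for \<open>(T * q, N)\<close>.\<close>

lemma qk_ip_Suc_Suc:
  assumes "n \<le> N" "m \<le> N"
  shows "(\<Sum>x\<le>Suc N. qk_weight q T (Suc N) x * qk q T (Suc N) (Suc n) x * qk q T (Suc N) (Suc m) x)
    = (1 - T * q) * (1 - 1 / q ^ Suc m) / (1 - 1 / q ^ Suc N)
      * (\<Sum>x\<le>N. qk_weight q (T * q) N x * qk q (T * q) N n x * qk q (T * q) N m x)"
proof -
  define c where "c = 1 - 1 / q ^ Suc m"
  have "qk_bdry q T N x * qk q (T * q) N n x * (qk q T (Suc N) (Suc m) (Suc x) - qk q T (Suc N) (Suc m) x)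
     = - ((1 - T * q) * c / (1 - 1 / q ^ Suc N)
      * (qk_weight q (T * q) N x * qk q (T * q) N n x * qk q (T * q) N m x))" for x
    unfolding qk_forward_shift[OF assms(2)] qk_bdry_def c_def[symmetric]
    using one_minus_T[of "Suc (2 * x)"] q_nz by (simp del: power_Suc)
  then show ?thesis
    by (simp only: qk_sum_by_parts[OF assms(1)] sum_negf sum_distrib_left minus_minus c_def)
qed

text \<open>
  Orthogonality of \<open>K\<^sub>1\<close> to \<open>1\<close> expresses the total mass through the first moment, and weight times
  \<open>\<phi>\<^sub>1\<close> is again a weight, for \<open>(T q\<^sup>2, N - 1)\<close>; this yields a recursion for the total mass.
\<close>

lemma qk_weight_basis_1:
  "qk_weight q T (Suc N) (Suc y) * qk_basis q T 1 (Suc y)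
   = - (1 - T * q) * (1 - T * q ^ 2) * (1 - 1 / q ^ Suc N) * q ^ Suc N
      / (T * q ^ 2 * (1 - T * q ^ Suc (Suc N))) * qk_weight q (T * q ^ 2) N y"
proof -
  have 1: "qpoch T q (Suc y) * (1 - T * q ^ Suc y) = (1 - T) * (1 - T * q) * qpoch (T * q ^ 2) q y"
    unfolding qpoch_Suc[symmetric] by (simp add: qpoch_Suc_shift power2_eq_square mult.assoc)
  have 2: "qpoch (1 / q ^ Suc N) q (Suc y) = (1 - 1 / q ^ Suc N) * qpoch (1 / q ^ N) q y"
    using q_nz by (simp add: qpoch_Suc_shift)
  have 3: "qpoch q q (Suc y) = qpoch q q y * (1 - q ^ Suc y)"
    by (simp add: qpoch_Suc)
  have 4: "qpoch (T * q ^ Suc (Suc N)) q (Suc y)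
     = (1 - T * q ^ Suc (Suc N)) * qpoch (T * q ^ 2 * q ^ Suc N) q y"
    by (simp add: qpoch_Suc_shift power2_eq_square ac_simps)
  have b: "qk_basis q T 1 (Suc y) = (1 - T * q ^ Suc y) * (- (1 - q ^ Suc y) / q ^ Suc y)"
    using q_nz by (simp add: qk_basis_def qpoch_def divide_simps)
  have e1: "T * q ^ (2 * Suc y) = T * q ^ 2 * q ^ (2 * y)"
    by (simp add: power2_eq_square)
  have e2: "(q ^ Suc N / T) ^ Suc y = q ^ Suc N / T * (q ^ N / (T * q ^ 2)) ^ y * q ^ y * q ^ y * q ^ y"
    using q_nz T_nz by (simp add: power_divide power_mult_distrib power2_eq_square ac_simps)
  have f: "q ^ (Suc y * Suc y) = q ^ (y * y) * q ^ y * q ^ y * q"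
    by (simp flip: power_add power_Suc) (simp add: algebra_simps)
  have nz: "1 - T \<noteq> 0" "1 - T * q ^ 2 \<noteq> 0" "1 - T * q ^ Suc (Suc N) \<noteq> 0" "1 - q ^ Suc y \<noteq> 0"
      "qpoch q q y \<noteq> 0" "qpoch (T * q ^ 2 * q ^ Suc N) q y \<noteq> 0"
    using one_minus_T[of 0] one_minus_T[of 2] one_minus_T[of "Suc (Suc N)"] q_pow[of "Suc y"] qpoch_q_nz qpoch_T_nz[of "2 + Suc N" y]
    by (simp_all add: power_add mult.assoc power2_eq_square)
  define u v w z where "u = 1 - T * q ^ Suc (Suc N)" and "v = 1 - T * q ^ 2"
    and "w = 1 - q ^ Suc y" and "z = 1 - T * q ^ 2 * q ^ (2 * y)"
  define g S R P P0 d B G where "g = q ^ (y * y)" and "S = qpoch q q y" and "R = qpoch (T * q ^ 2 * q ^ Suc N) q y"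
    and "P = qpoch (T * q ^ 2) q y" and "P0 = qpoch (1 / q ^ N) q y" and "d = 1 - 1 / q ^ Suc N"
    and "B = q ^ Suc N" and "G = (q ^ N / (T * q ^ 2)) ^ y"
  have nz2: "g \<noteq> 0" "B \<noteq> 0" using q_nz by (simp_all add: g_def B_def)
  define X where "X = q ^ y"
  have X: "X \<noteq> 0" "q ^ Suc y = q * X" using q_nz by (simp_all add: X_def)
  have "qk_weight q T (Suc N) (Suc y) * qk_basis q T 1 (Suc y)
    = (qpoch T q (Suc y) * (1 - T * q ^ Suc y)) * (d * P0) * z * (B / T * G * X * X * X)
      / ((1 - T) * (S * w) * (u * R) * (g * X * X * q)) * (- w / (q * X))"
    unfolding qk_weight_def b 2 3 4 e1 e2 f
    unfolding u_def[symmetric] w_def[symmetric] z_def[symmetric] g_def[symmetric] S_def[symmetric]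
      R_def[symmetric] P0_def[symmetric] d_def[symmetric] G_def[symmetric]
    unfolding B_def[symmetric] X_def[symmetric] X(2)
    by simp
  also have "\<dots> = ((1 - T) * (1 - T * q) * P) * (d * P0) * z * (B / T * G * X * X * X)
      / ((1 - T) * (S * w) * (u * R) * (g * X * X * q)) * (- w / (q * X))"
    unfolding 1 P_def ..
  also have "\<dots> = - (1 - T * q) * v * d * B / (T * q ^ 2 * u)
        * (P * P0 * z * G / (v * S * R * g))"
    using nz[folded u_def v_def w_def S_def R_def] nz2 X q_nz T_nz by (simp add: field_simps power2_eq_square)
  finally show ?thesis
    unfolding qk_weight_def
    unfolding u_def v_def d_def B_def P_def P0_def z_def G_def S_def R_def g_def by simp
qed

lemma qk_mass_Suc:
  "(\<Sum>x\<le>Suc N. qk_weight q T (Suc N) x)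
   = - (1 - T * q) * (1 - T * q ^ 2) * q ^ Suc N / (T * q ^ 2 * (1 - T * q ^ Suc (Suc N)))
     * (\<Sum>x\<le>N. qk_weight q (T * q ^ 2) N x)"
proof -
  define k where "k = 1 - 1 / q ^ Suc N"
  have k: "k \<noteq> 0"
    using q_pow[of "Suc N"] q_nz by (auto simp: k_def field_simps)
  have "1 - q \<noteq> 0"
    using q_pow[of 1] by simp
  then have "qk q T (Suc N) 1 x = 1 - qk_basis q T 1 x / k" for x
    using q_nz k unfolding k_def
    by (simp add: qk_def qk_coeff_def qpoch_def divide_simps qk_basis_def) (simp add: algebra_simps)
  then have "(\<Sum>x\<le>Suc N. qk_weight q T (Suc N) x)
      = (\<Sum>x\<le>Suc N. qk_weight q T (Suc N) x * qk_basis q T 1 x) / k"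
    using qk_ip_Suc_0[of 0 N]
    by (simp add: right_diff_distrib sum_subtractf sum_divide_distrib add_divide_distrib diff_divide_distrib)
  \<comment> \<open>The basis function of index 1 vanishes at \<open>x = 0\<close>.\<close>
  also have "(\<Sum>x\<le>Suc N. qk_weight q T (Suc N) x * qk_basis q T 1 x)
      = (\<Sum>y\<le>N. qk_weight q T (Suc N) (Suc y) * qk_basis q T 1 (Suc y))"
    by (subst sum.atMost_Suc_shift) (simp add: qk_basis_def qpoch_def)
  also have "\<dots> = - (1 - T * q) * (1 - T * q ^ 2) * k * q ^ Suc N
      / (T * q ^ 2 * (1 - T * q ^ Suc (Suc N))) * (\<Sum>y\<le>N. qk_weight q (T * q ^ 2) N y)"
    by (simp only: qk_weight_basis_1 sum_distrib_left k_def)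
  finally show ?thesis
    using k by (simp add: mult_ac)
qed

end

section \<open>Total mass and the orthogonality relation\<close>

lemma qk_mass:
  "qk_generic q T \<Longrightarrow> (\<Sum>x\<le>N. qk_weight q T N x) = qpoch (1 / (T * q ^ N)) q N"
proof (induction N arbitrary: T)
  case 0
  then interpret qk_generic q T .
  show ?case
    using T_ne_1 by (simp add: qk_weight_def)
next
  case (Suc N)
  interpret qk_generic q T by fact
  define u v w where "u = 1 - T * q" and "v = 1 - T * q ^ 2" and "w = 1 - T * q ^ Suc (Suc N)"
  have nz: "u \<noteq> 0" "v \<noteq> 0" "w \<noteq> 0"
    using one_minus_T[of 1] one_minus_T[of 2] one_minus_T[of "Suc (Suc N)"] by (simp_all add: u_def v_def w_def)
  define P where "P = qpoch (1 / (T * q ^ 2 * q ^ N)) q N"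
  \<comment> \<open>Splitting off the first factor here and the last factor in \<open>b\<close>
    connects the product from the induction hypothesis with the one in the claim.\<close>
  have a: "qpoch (1 / (T * q ^ 2 * q ^ N)) q (Suc N) = (1 - 1 / (T * q ^ Suc (Suc N))) * qpoch (1 / (T * q ^ Suc N)) q N"
    using q_nz by (simp add: qpoch_Suc_shift power2_eq_square mult_ac)
  have b: "qpoch (1 / (T * q ^ 2 * q ^ N)) q (Suc N) = P * (1 - 1 / (T * q ^ 2))"
    using q_nz by (simp add: qpoch_Suc P_def)
  have c: "qpoch (1 / (T * q ^ Suc N)) q (Suc N) = qpoch (1 / (T * q ^ Suc N)) q N * (1 - 1 / (T * q))"
    using q_nz by (simp add: qpoch_Suc)
  have d: "1 - 1 / (T * q ^ Suc (Suc N)) = - w / (T * q ^ Suc (Suc N))" "1 - 1 / (T * q ^ 2) = - v / (T * q ^ 2)"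
     "1 - 1 / (T * q) = - u / (T * q)"
    using q_nz T_nz by (simp_all add: w_def v_def u_def field_simps)
  have "P * (- v / (T * q ^ 2)) = - w / (T * q ^ Suc (Suc N)) * qpoch (1 / (T * q ^ Suc N)) q N"
    using a b d by simp
  then have "qpoch (1 / (T * q ^ Suc N)) q N = P * v * q ^ N / w"
    using nz q_nz T_nz by (simp add: field_simps power2_eq_square)
  then have "qpoch (1 / (T * q ^ Suc N)) q (Suc N) = - u * v * q ^ Suc N / (T * q ^ 2 * w) * P"
    unfolding c d using q_nz T_nz by (simp add: field_simps power2_eq_square)
  then show ?case
    unfolding qk_mass_Suc Suc.IH[OF shift] u_def v_def w_def P_def by simp
qed

text \<open>Induction on \<open>N\<close>: \<open>qk_ip_Suc_Suc\<close> lowers both degrees and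
  passes to \<open>(T * q, N)\<close>. If exactly one degree is zero, \<open>qk_ip_Suc_0\<close>
  applies; if both are, the sum is the total mass.\<close>

theorem qk_orthogonality:
  assumes "qk_generic q T" "n \<le> N" "m \<le> N"
  shows "(\<Sum>x\<le>N. qk_weight q T N x * qk q T N n x * qk q T N m x)
    = (if n = m then qpoch (1 / (T * q ^ N)) q N * qpoch q q n * T ^ n / qpoch (1 / q ^ N) q n else 0)"
  using assms
proof (induction N arbitrary: T n m)
  case 0
  then show ?case
    using qk_mass[of q T 0] by (simp add: qk_def qk_coeff_def qk_basis_def)
next
  case (Suc N)
  interpret qk_generic q T by fact
  have K0: "qk q T (Suc N) 0 x = 1" for x
    by (simp add: qk_def qk_coeff_def qk_basis_def)
  show ?case
  proof (cases n)
    case n: 0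
    show ?thesis
    proof (cases m)
      case 0
      with n show ?thesis using qk_mass[OF Suc.prems(1), of "Suc N"] by (simp only: K0) simp
    next
      case (Suc m')
      with n show ?thesis using qk_ip_Suc_0[of m' N] Suc.prems by (simp only: K0) simp
    qed
  next
    case n: (Suc n')
    show ?thesis
    proof (cases m)
      case 0
      with n show ?thesis using qk_ip_Suc_0[of n' N] Suc.prems by (simp only: K0) simp
    next
      case m: (Suc m')
      have gen: "qk_generic q (T * q)"
        using shift[of 1] by simp
      have le: "n' \<le> N" "m' \<le> N"
        using Suc.prems n m by auto
      have e: "T * q * q ^ N = T * q ^ Suc N" by simp
      have 1: "qpoch (1 / (T * q ^ Suc N)) q (Suc N) = qpoch (1 / (T * q ^ Suc N)) q N * (1 - 1 / (T * q))"
        using q_nz by (simp add: qpoch_Suc)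
      have 2: "qpoch (1 / q ^ Suc N) q (Suc m') = (1 - 1 / q ^ Suc N) * qpoch (1 / q ^ N) q m'"
        using q_nz by (simp add: qpoch_Suc_shift)
      have 3: "qpoch q q (Suc m') = qpoch q q m' * (1 - q ^ Suc m')"
        by (simp add: qpoch_Suc)
      have 4: "1 - 1 / q ^ Suc m' = - (1 - q ^ Suc m') / q ^ Suc m'" "1 - 1 / (T * q) = - (1 - T * q) / (T * q)"
        using q_nz T_nz by (simp_all add: divide_simps)
      define A B C E where "A = qpoch (1 / (T * q ^ Suc N)) q N" and "B = 1 - 1 / q ^ Suc N"
         and "C = qpoch (1 / q ^ N) q m'" and "E = 1 - q ^ Suc m'"
      define u where "u = 1 - T * q"
      have nz: "B \<noteq> 0" "C \<noteq> 0"
        using q_pow[of "Suc N"] q_nz qpoch_inverse_pow_nz[OF le(2)] by (simp_all add: B_def C_def)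
      show ?thesis
      proof (cases "n' = m'")
        case True
        show ?thesis
          unfolding n m True qk_ip_Suc_Suc[OF le(2) le(2)] Suc.IH[OF gen le(2) le(2)] e 1 2 3 4
          unfolding A_def[symmetric] B_def[symmetric] C_def[symmetric] E_def[symmetric] u_def[symmetric]
          using q_nz T_nz nz by (simp add: field_simps power_mult_distrib)
      qed (simp add: n m qk_ip_Suc_Suc[OF le] Suc.IH[OF gen le] del: sum.atMost_Suc)
    qed
  qed
qed

section \<open>The nodes and the weights\<close>

lemma qpoch_reverse:
  assumes "a \<noteq> 0" "q \<noteq> 0"
  shows "qpoch a q n = (- a) ^ n * (\<Prod>k<n. q ^ k) * qpoch (q / (a * q ^ n)) q n"
  using assms
proof (induction n arbitrary: a)
  case (Suc n)
  have "qpoch a q (Suc n) = (1 - a) * ((- (a * q)) ^ n * (\<Prod>k<n. q ^ k) * qpoch (q / (a * q * q ^ n)) q n)"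
    using Suc.IH[of "a * q"] Suc.prems by (simp add: qpoch_Suc_shift)
  also have "(- (a * q)) ^ n = (- a) ^ n * q ^ n"
    by (simp flip: power_mult_distrib)
  also have "(1 - a) = - a * (1 - 1 / a)"
    using Suc.prems by (simp add: field_simps)
  finally show ?case
    using Suc.prems by (simp add: qpoch_Suc mult_ac)
qed simp

text \<open>Two uses of \<open>qpoch_reverse\<close> leave the square of this product; with one more
  \<open>q ^ n\<close> it matches the power \<open>q ^ (x * x)\<close> of \<open>qk_weight\<close>
  at \<open>x = n\<close>.\<close>

lemma prod_powers_square: "(\<Prod>k<n. q ^ k) * (\<Prod>k<n. q ^ k) * q ^ n = (q :: complex) ^ (n * n)"
proof (induction n)
  case (Suc n)
  have e: "q ^ (Suc n * Suc n) = q ^ (n * n) * q ^ n * q ^ n * q"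
    by (simp flip: power_add power_Suc) (simp add: algebra_simps)
  show ?case
    unfolding e Suc.IH[symmetric] by (simp add: mult_ac)
qed simp

text \<open>With \<open>n = D - 1\<close> this is the index range of \<open>ipL\<close>: the nodes
  pair up by sign, except for 0 and \<open>- int D\<close>.\<close>

lemma sum_pairs_int:
  fixes F :: "int \<Rightarrow> complex"
  shows "(\<Sum>i\<in>{- int (Suc n)..int n}. F i)
    = F 0 + F (- int (Suc n)) + (\<Sum>k\<in>{1..n}. F (int k) + F (- int k))"
proof (induction n)
  case 0
  have "{-1..0::int} = {-1, 0}" by auto
  then show ?case by simp
next
  case (Suc n)
  have "{- int (Suc (Suc n))..int (Suc n)} = insert (- int (Suc (Suc n))) (insert (int (Suc n)) {- int (Suc n)..int n})"
    by auto
  then show ?case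
    using Suc.IH by (simp add: add_ac)
qed

lemma cnj_qpoch: "cnj (qpoch a q n) = qpoch (cnj a) (cnj q) n"
  by (simp add: qpoch_def)

lemma cnj_qk: "cnj (qk q T N n x) = qk (cnj q) (cnj T) N n x"
  by (simp add: qk_def qk_coeff_def qk_basis_def cnj_qpoch)

lemma qp_add: "0 < q \<Longrightarrow> qp q (a + b) = qp q a * qp q b"
  by (simp add: qp_def powr_add)

lemma qp_diff: "0 < q \<Longrightarrow> qp q (a - b) = qp q a / qp q b"
  by (simp add: qp_def powr_diff)

lemma qp_minus: "qp q (- a) = 1 / qp q a"
  by (simp add: qp_def powr_minus divide_inverse)

lemma qp_of_nat: "0 < q \<Longrightarrow> qp q (real n) = of_real q ^ n"
  by (simp add: qp_def powr_realpow)

lemma qp_1: "0 < q \<Longrightarrow> qp q 1 = of_real q"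
  by (simp add: qp_def)

lemma qp_2: "0 < q \<Longrightarrow> qp q 2 = of_real q ^ 2"
  using qp_of_nat[of q 2] by simp

lemma qp_of_nat_mult:
  assumes "0 < q"
  shows "qp q (real n * a) = qp q a ^ n"
proof -
  have "q powr (real n * a) = (q powr a) ^ n"
    using assms by (metis mult.commute powr_powr powr_realpow powr_gt_zero less_irrefl)
  then show ?thesis
    by (simp add: qp_def)
qed

lemma qp_nz: "0 < q \<Longrightarrow> qp q a \<noteq> 0"
  by (simp add: qp_def)

text \<open>The series is symmetric in \<open>t / eta\<close> and \<open>t * eta\<close>. The two
  alternatives are a node and its inverse, which therefore get the same value.\<close>

lemma hfun_eq_qk:
  fixes q :: real
  assumes "0 < q"
    and "(t / eta = 1 / of_real q ^ x \<and> t * eta = T * of_real q ^ x) \<or>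
         (t / eta = T * of_real q ^ x \<and> t * eta = 1 / of_real q ^ x)"
  shows "hfun q t d i eta = qpoch (1 / of_real q ^ d) (of_real q) i / t ^ i * qk (of_real q) T d i x"
proof -
  have "qpoch (t / eta) (of_real q) n * qpoch (t * eta) (of_real q) n = qk_basis (of_real q) T n x" for n
    using assms(2) by (auto simp: qk_basis_def)
  then show ?thesis
    unfolding hfun_def qk_def qk_coeff_def qp_minus qp_of_nat[OF assms(1)]
    by (auto intro!: sum.cong simp: mult.assoc)
qed

section \<open>The parameters of the nodes\<close>

locale dual_polar_nodes =
  fixes q :: real and D :: nat and e :: real
  assumes q_gt_1: "1 < q" and D_ge_2: "2 \<le> D"
begin

definition Q :: complex where "Q = complex_of_real q"
definition E :: complex where "E = qp q e"
definition T :: complex where "T = - 1 / (Q ^ D * E)"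
definition t :: complex where "t = tau q D e"
text \<open>Since \<open>1 / (T * Q ^ D) = - E\<close>, this is by \<open>qk_mass\<close> the total
  mass of the Krawtchouk weight for \<open>(T, D)\<close>.\<close>

definition M :: complex where "M = qpoch (- E) Q D"

lemma q_pos: "0 < q"
  using q_gt_1 by simp

text \<open>Turns the real powers in the weights into monomials in \<open>Q\<close> and
  \<open>E\<close>, for which field arithmetic suffices.\<close>

lemmas qp_simps = qp_add[OF q_pos] qp_diff[OF q_pos] qp_minus qp_of_nat[OF q_pos, folded Q_def]
  qp_1[OF q_pos, folded Q_def] qp_2[OF q_pos, folded Q_def] qp_of_nat_mult[OF q_pos] E_def[symmetric]

lemma nz: "Q \<noteq> 0" "E \<noteq> 0" "T \<noteq> 0" "t \<noteq> 0"
  using q_gt_1 by (simp_all add: Q_def E_def T_def t_def tau_def qp_nz)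

lemma cnj_real: "cnj Q = Q" "cnj E = E" "cnj T = T" "cnj t = - t"
  by (simp_all add: Q_def E_def T_def t_def tau_def qp_def)

lemma pos_sum_nz: "0 < a \<Longrightarrow> 0 < b \<Longrightarrow> complex_of_real a + complex_of_real b \<noteq> 0"
  by (metis add_pos_pos less_irrefl of_real_0 of_real_add of_real_eq_iff)

lemma E_pow_nz: "E * Q ^ m + Q ^ n \<noteq> 0"
  using pos_sum_nz[of "(q powr e) * q ^ m" "q ^ n"] q_pos by (simp add: E_def Q_def qp_def)

lemma E_pow_ne: "- (E * Q ^ m) \<noteq> Q ^ n" "- (E * Q ^ m) \<noteq> 1" "- (Q ^ n) \<noteq> E"
proof -
  show "- (E * Q ^ m) \<noteq> Q ^ n" "- (E * Q ^ m) \<noteq> 1"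
    using E_pow_nz[of m n] E_pow_nz[of m 0] by (auto simp: add_eq_0_iff)
  show "- (Q ^ n) \<noteq> E"
    using E_pow_nz[of 0 n] by (metis ab_left_minus mult.right_neutral power_0)
qed

lemma Q_pow_ne_1: "0 < n \<Longrightarrow> Q ^ n \<noteq> 1"
proof -
  assume "0 < n"
  then have "q ^ n \<noteq> 1"
    using one_less_power[OF q_gt_1] by (metis less_irrefl)
  then show ?thesis
    unfolding Q_def by (metis of_real_1 of_real_eq_iff of_real_power)
qed

text \<open>\<open>T\<close> is a negative real and \<open>Q\<close> is a real above 1, so neither
  kind of product can hit 1.\<close>

lemma generic: "qk_generic Q T"
proof
  show "T * Q ^ n \<noteq> 1" for n
    using E_pow_nz[of D n] nz by (auto simp: T_def field_simps add_eq_0_iff)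
qed (use nz Q_pow_ne_1 in auto)

sublocale gen: qk_generic Q T
  by (rule generic)

lemma t_square: "t * t = T"
proof -
  have "t * t = - (qp q (- (real D + e) / 2) * qp q (- (real D + e) / 2))"
    by (simp add: t_def tau_def algebra_simps)
  also have "\<dots> = - qp q (- (real D + e))"
    by (simp flip: qp_add[OF q_pos])
  also have "\<dots> = T"
    unfolding qp_simps by (simp add: T_def)
  finally show ?thesis .
qed

section \<open>Values of the functions at the nodes\<close>

definition H :: "nat \<Rightarrow> nat \<Rightarrow> complex" where
  "H n x = qpoch (1 / Q ^ D) Q n / t ^ n * qk Q T D n x"

text \<open>The parameter \<open>t * Q\<close> has square \<open>T * Q ^ 2\<close>, and its quotient
  by the node \<open>t * Q ^ k\<close> is \<open>1 / Q ^ (k - 1)\<close> for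
  \<open>k \<ge> 1\<close>. So the points from 1 to \<open>D - 1\<close> become the grid from 0 to
  \<open>D - 2\<close>.\<close>

definition Hp :: "nat \<Rightarrow> nat \<Rightarrow> complex" where
  "Hp n x = qpoch (1 / Q ^ (D - 2)) Q n / (t * Q) ^ n * qk Q (T * Q ^ 2) (D - 2) n (x - 1)"

text \<open>This and \<open>Pm\<close> are the values of \<open>pperp\<close> at a node and at its
  inverse. Both are purely imaginary, \<open>t\<close> being the only non-real factor.\<close>

definition Pp :: "nat \<Rightarrow> complex" where
  "Pp k = (1 - 1 / Q ^ k) * (T * Q ^ k - 1 / Q ^ D) / t"

definition Pm :: "nat \<Rightarrow> complex" where
  "Pm k = (1 - T * Q ^ k) * (1 / Q ^ k - 1 / Q ^ D) / t"

lemma lam_nonneg: "lam q D e (int k) = t * Q ^ k"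
  by (simp add: lam_def t_def qp_simps)

lemma lam_neg: "0 < k \<Longrightarrow> lam q D e (- int k) = 1 / (t * Q ^ k)"
  by (simp add: lam_def t_def qp_simps field_simps)

lemma hh_lam: "hh q D e i (lam q D e (int k)) = H i k"
  unfolding hh_def H_def t_def[symmetric] Q_def
  by (rule hfun_eq_qk[OF q_pos])
    (use nz in \<open>simp add: lam_nonneg t_square[symmetric] flip: Q_def\<close>)

lemma hh_lam_neg: "0 < k \<Longrightarrow> hh q D e i (lam q D e (- int k)) = H i k"
  unfolding hh_def H_def t_def[symmetric] Q_def
  by (rule hfun_eq_qk[OF q_pos])
    (use nz in \<open>simp add: lam_neg t_square[symmetric] flip: Q_def\<close>)

lemma hperp_lam:
  assumes "i \<le> D - 2" "0 < k"
  shows "hperp q D e (int i) (lam q D e (int k)) = Hp i k"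
proof -
  have "hperp q D e (int i) (lam q D e (int k)) = hfun q (t * of_real q) (D - 2) i (lam q D e (int k))"
    using assms D_ge_2 by (simp add: hperp_def t_def)
  also have "\<dots> = Hp i k"
    unfolding Hp_def Q_def
    by (rule hfun_eq_qk[OF q_pos], cases k)
      (use nz assms in \<open>simp_all add: lam_nonneg t_square[symmetric] power2_eq_square flip: Q_def del: of_nat_Suc\<close>)
  finally show ?thesis .
qed

lemma hperp_lam_neg:
  assumes "i \<le> D - 2" "0 < k"
  shows "hperp q D e (int i) (lam q D e (- int k)) = Hp i k"
proof -
  have "hperp q D e (int i) (lam q D e (- int k)) = hfun q (t * of_real q) (D - 2) i (lam q D e (- int k))"
    using assms D_ge_2 by (simp add: hperp_def t_def)
  also have "\<dots> = Hp i k"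
    unfolding Hp_def Q_def
    by (rule hfun_eq_qk[OF q_pos], cases k)
      (use nz assms in \<open>simp_all add: lam_neg t_square[symmetric] power2_eq_square flip: Q_def del: of_nat_Suc\<close>)
  finally show ?thesis .
qed

text \<open>The product has a zero factor for \<open>n = k\<close>. As \<open>pperp\<close> vanishes
  at the two unpaired nodes, no node sees the second term of
  \<open>ell q D e True (D - 1)\<close>.\<close>

lemma hperp_top:
  assumes "1 \<le> k" "k \<le> D - 1"
  shows "hperp q D e (int D - 1) (lam q D e (int k)) = 0"
    and "hperp q D e (int D - 1) (lam q D e (- int k)) = 0"
proof -
  have "lam q D e (int k) - tau q D e * qp q (real k) = 0"
    by (simp add: lam_nonneg qp_simps flip: t_def)
  moreover have "lam q D e (- int k) - inverse (tau q D e) * qp q (- real k) = 0"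
    using assms by (simp add: lam_neg qp_simps field_simps flip: t_def)
  ultimately show "hperp q D e (int D - 1) (lam q D e (int k)) = 0"
    and "hperp q D e (int D - 1) (lam q D e (- int k)) = 0"
    using assms unfolding hperp_def by (auto intro!: bexI[of _ k])
qed

lemma pperp_lam: "pperp q D e (lam q D e (int k)) = Pp k"
  using nz unfolding pperp_def lam_nonneg Pp_def
  by (simp add: qp_simps t_square[symmetric] divide_simps flip: t_def) (simp add: algebra_simps)

lemma pperp_lam_neg: "0 < k \<Longrightarrow> pperp q D e (lam q D e (- int k)) = Pm k"
  using nz unfolding pperp_def Pm_def
  by (simp add: lam_neg qp_simps t_square[symmetric] divide_simps flip: t_def)

lemma Pp_0: "Pp 0 = 0" and Pm_D: "Pm D = 0"
  by (simp_all add: Pp_def Pm_def)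

lemma cnj_Pp: "cnj (Pp k) = - Pp k" and cnj_Pm: "cnj (Pm k) = - Pm k"
  by (simp_all add: Pp_def Pm_def cnj_real)

section \<open>Comparison of the given weights with the two Krawtchouk weights\<close>

definition W :: "nat \<Rightarrow> complex" where "W k = qk_weight Q T D k / M"

text \<open>The divisor is again the total mass, now for \<open>(T * Q ^ 2, D - 2)\<close>, because
  \<open>1 / (T * Q ^ 2 * Q ^ (D - 2)) = - E\<close>.\<close>

definition Wp :: "nat \<Rightarrow> complex" where
  "Wp k = qk_weight Q (T * Q ^ 2) (D - 2) (k - 1) / qpoch (- E) Q (D - 2)"

text \<open>The ratio between the quadratic expression in the last part of
  \<open>weight_relations\<close> and \<open>Wp\<close>.\<close>

definition K :: complex where "K = (1 - 1 / Q ^ D) * (Q ^ D - Q)"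

lemma qpoch_E_nz: "qpoch (- E / Q ^ m) Q n \<noteq> 0" "qpoch (- E) Q n \<noteq> 0"
  using E_pow_ne nz by (auto simp: qpoch_eq_0_iff field_simps)

lemma qpoch_inv_E_nz: "qpoch (- 1 / E) Q n \<noteq> 0" "qpoch (- Q / E) Q n \<noteq> 0"
  using E_pow_ne(3) nz by (auto simp: qpoch_eq_0_iff field_simps simp flip: power_Suc)

lemma T_eqs: "T * Q ^ Suc D = - Q / E" "1 / (T * Q ^ D) = - E"
  using nz by (simp_all add: T_def)

lemma wt_0: "wt q D e 0 = W 0"
  using gen.T_ne_1 by (simp add: wt_def W_def M_def qk_weight_def qp_simps flip: Q_def)

text \<open>Reversing \<open>qpoch T Q D\<close> and \<open>qpoch (1 / Q ^ D) Q D\<close> makes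
  \<open>qpoch Q Q D\<close> and the large powers cancel. The remaining two products are one-step
  shifts of \<open>M\<close> and of \<open>qpoch (- 1 / E) Q D\<close>.\<close>

lemma wt_minus_D: "wt q D e (- int D) = W D"
proof -
  define g where "g = (\<Prod>k<D. Q ^ k)"
  define B where "B = Q ^ D"
  have g: "g * g * B = Q ^ (D * D)"
    unfolding g_def B_def by (rule prod_powers_square)
  have B: "B \<noteq> 0" and g_nz: "g \<noteq> 0"
    using nz by (auto simp: B_def g_def)
  have TQ: "Q / (T * Q ^ D) = - E * Q"
    using nz by (simp add: T_def)
  have 1: "qpoch T Q D = (- T) ^ D * g * qpoch (- E * Q) Q D"
    using qpoch_reverse[of T Q D] nz by (simp add: TQ g_def)
  have 2: "qpoch (1 / B) Q D = (- (1 / B)) ^ D * g * qpoch Q Q D"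
    using qpoch_reverse[of "1 / B" Q D] nz by (simp add: g_def B_def)
  have 3: "(1 + E) * qpoch (- E * Q) Q D = M * (1 + E * B)"
    using qpoch_shift[of "- E" Q D] by (simp add: M_def B_def)
  have 4: "(1 + 1 / E) * qpoch (- Q / E) Q D = qpoch (- 1 / E) Q D * (1 + B / E)"
    using qpoch_shift[of "- 1 / E" Q D] by (simp add: B_def)
  have E1: "1 + E \<noteq> 0" "1 + E * B \<noteq> 0" "E + B \<noteq> 0"
    using E_pow_nz[of 0 0] E_pow_nz[of D 0] E_pow_nz[of 0 D] by (simp_all add: B_def add.commute)
  have M: "M \<noteq> 0" using qpoch_E_nz by (simp add: M_def)
  have S: "qpoch Q Q D \<noteq> 0" by (rule gen.qpoch_q_nz)
  have R: "qpoch (- 1 / E) Q D \<noteq> 0" "qpoch (- Q / E) Q D \<noteq> 0" by (rule qpoch_inv_E_nz)+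
  have T: "T = - 1 / (B * E)" by (simp add: T_def B_def)
  have B2: "Q ^ (2 * D) = B * B" by (simp add: B_def mult_2 power_add)
  have p: "(- T) ^ D * (- (1 / B)) ^ D * (B / T) ^ D = 1"
    using nz B by (simp flip: power_mult_distrib)
  define U where "U = qpoch (- E * Q) Q D"
  have "W D = ((- T) ^ D * (- (1 / B)) ^ D * (B / T) ^ D) * (g * g) * U * qpoch Q Q D * (1 - T * (B * B))
     / ((1 - T) * qpoch Q Q D * qpoch (- Q / E) Q D * (g * g * B) * M)"
    unfolding W_def qk_weight_def T_eqs B_def[symmetric] 1 2 g[symmetric] B2 U_def[symmetric]
    by (simp add: mult_ac)
  also have "\<dots> = U * (1 - T * (B * B)) / ((1 - T) * qpoch (- Q / E) Q D * B * M)"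
    unfolding p using S g_nz by (simp add: mult_ac)
  also have "U = M * (1 + E * B) / (1 + E)"
    using 3 E1 by (simp add: U_def field_simps)
  also have "qpoch (- Q / E) Q D = qpoch (- 1 / E) Q D * (B + E) / (1 + E)"
    using 4 E1 nz by (simp add: field_simps)
  also have "M * (1 + E * B) / (1 + E) * (1 - T * (B * B)) / ((1 - T) * (qpoch (- 1 / E) Q D * (B + E) / (1 + E)) * B * M)
     = 1 / qpoch (- 1 / E) Q D"
  proof -
    define u v w where "u = 1 + E" and "v = 1 + E * B" and "w = E + B"
    have "1 - T * (B * B) = w / E" "1 - T = v / (E * B)" "B + E = w"
      unfolding T u_def v_def w_def using nz B by (simp_all add: field_simps)
    moreover have "u \<noteq> 0" "v \<noteq> 0" "w \<noteq> 0"
      using E1 by (simp_all add: u_def v_def w_def)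
    ultimately show ?thesis
      unfolding u_def[symmetric] v_def[symmetric] using M B nz R by simp
  qed
  finally show ?thesis
    using D_ge_2 by (simp add: wt_def qp_simps flip: Q_def)
qed

text \<open>A bridge between two kinds of products: those in \<open>T\<close> and
  \<open>- Q / E\<close> come from the Krawtchouk weight, the one in \<open>- E * Q / X\<close> from
  the given weights. Raising \<open>k\<close> by one changes each of them by end factors
  only.\<close>

lemma qpoch_weight_quotient:
  assumes "B = Q ^ D" "X = Q ^ k"
  shows "qpoch (- E * Q / X) Q (D - 1) * qpoch T Q k * B ^ k * (E + X) * (X + E * B)
    = qpoch (- Q / E) Q k * M * X * (1 + E * B)"
  using assms(2)
proof (induction k arbitrary: X)
  case 0
  have "M = (1 + E) * qpoch (- E * Q) Q (D - 1)"
    using D_ge_2 unfolding M_def by (cases D) (simp_all add: qpoch_Suc_shift)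
  then show ?case
    using 0 by (simp add: algebra_simps)
next
  case (Suc k)
  define Y where "Y = Q ^ k"
  have X: "X = Q * Y" using Suc.prems by (simp add: Y_def)
  have B: "B \<noteq> 0" "Y \<noteq> 0" "X \<noteq> 0" using assms(1) nz by (simp_all add: Y_def X)
  have QB: "Q ^ (D - 1) = B / Q"
    using assms(1) nz D_ge_2 by (cases D) simp_all
  define G G' where "G = qpoch (- E * Q / Y) Q (D - 1)" and "G' = qpoch (- E * Q / X) Q (D - 1)"
  have "G' = qpoch (- E / Y) Q (D - 1)"
    using nz by (simp add: G'_def X)
  then have g: "(1 + E / Y) * G = G' * (1 + E * B / X)"
    using qpoch_shift[of "- E / Y" Q "D - 1"] by (simp add: G_def QB[simplified] X mult_ac)
  have IH: "G * qpoch T Q k * B ^ k * (E + Y) * (Y + E * B) = qpoch (- Q / E) Q k * M * Y * (1 + E * B)"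
    unfolding G_def by (rule Suc.IH[OF Y_def])
  have 1: "qpoch T Q (Suc k) = qpoch T Q k * ((Y + E * B) / (E * B))"
    using nz B by (simp add: qpoch_Suc T_def assms(1) Y_def field_simps)
  have 2: "qpoch (- Q / E) Q (Suc k) = qpoch (- Q / E) Q k * ((E + X) / E)"
    using nz B by (simp add: qpoch_Suc X Y_def field_simps)
  have g': "G' * (X + E * B) = Q * ((E + Y) * G)"
  proof -
    have "Q * ((E + Y) * G) = X * ((1 + E / Y) * G)"
      using B by (simp add: X field_simps)
    also have "\<dots> = G' * (X + E * B)"
      unfolding g using B by (simp add: field_simps)
    finally show ?thesis ..
  qed
  have "G' * qpoch T Q (Suc k) * B ^ Suc k * (E + X) * (X + E * B)
     = (G' * (X + E * B)) * qpoch T Q k * ((Y + E * B) / E) * B ^ k * (E + X)"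
    unfolding 1 using B nz by (simp add: field_simps)
  also have "\<dots> = Q * (E + X) / E * (G * qpoch T Q k * B ^ k * (E + Y) * (Y + E * B))"
    unfolding g' by (simp add: mult_ac)
  also have "\<dots> = qpoch (- Q / E) Q (Suc k) * M * X * (1 + E * B)"
    unfolding IH 2 by (simp add: X mult_ac)
  finally show ?case
    unfolding G'_def .
qed

text \<open>Everything that is not rational in \<open>B\<close>, \<open>X\<close> and
  \<open>E\<close> is collected in \<open>Z\<close>, which stays opaque to the users; relations
  between the weights become rational identities.\<close>

lemma weights_common_factor:
  assumes "1 \<le> k" "k \<le> D - 1" and "B = Q ^ D" "X = Q ^ k"
  obtains Z where
    "wt q D e (int k) = Z * ((1 - X / B) * (1 + B + B * E / X - B / X) / ((1 - X) * (1 + E / X)))"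
    "wt q D e (- int k) = - (Z * (B * E * (1 + B + X / E - X) / (X * X * (1 + E * B / X))))"
    "cwt q D e k = Z * (B * (1 - X / B) / X)"
    "W k = Z * ((1 + B * E / (X * X)) * (1 + B * E / (X * X)) * X ^ 3 * (1 - 1 / B) / ((E + X) * (X + E * B) * (1 - X)))"
proof -
  obtain y where k: "k = Suc y"
    using assms(1) by (cases k) auto
  obtain n where D: "D = Suc n"
    using D_ge_2 by (cases D) auto
  have nz': "B \<noteq> 0" "X \<noteq> 0" using assms nz by auto
  have QB: "Q ^ n = B / Q" "Q ^ y = X / Q"
    using assms(3,4) nz D k by simp_all
  define P S G where "P = qpoch (Q / B) Q y" and "S = qpoch Q Q y" and "G = qpoch (- E * Q / X) Q n"
  define m where "m = 1 + B * E / (X * X)"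
  define Z where "Z = (- 1) ^ k * (B * E / X) ^ k * P / (S * G * m)"
  have nz2: "S \<noteq> 0" "G \<noteq> 0" "M \<noteq> 0"
    using gen.qpoch_q_nz qpoch_E_nz(1)[of y n] qpoch_E_nz(2) nz
    by (auto simp: S_def G_def assms(4) k M_def)
  have sums: "E + X \<noteq> 0" "X + E * B \<noteq> 0" "1 + E * B \<noteq> 0"
    using E_pow_nz[of 0 k] E_pow_nz[of D k] E_pow_nz[of D 0] by (simp_all add: assms add.commute)
  have X1: "1 - X \<noteq> 0"
    using Q_pow_ne_1[of k] assms by simp
  have P1: "qpoch (Q / B) Q k = P * (1 - X / B)"
    using nz by (simp add: k P_def qpoch_Suc QB)
  have S1: "qpoch Q Q k = S * (1 - X)"
    using nz by (simp add: k S_def qpoch_Suc QB)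
  have G1: "qpoch (- E / X) Q D = (1 + E / X) * G"
    by (simp add: D qpoch_Suc_shift G_def)
  have G2: "qpoch (- E * Q / X) Q D = G * (1 + E * B / X)"
    using nz by (simp add: D qpoch_Suc G_def QB)
  have pows: "Q ^ (k * 2) = X * X"
    by (simp add: assms(4) mult_2_right power_add)
  have y: "k - 1 = y" by (simp add: k)
  have n: "D - 1 = n" by (simp add: D)
  have qps: "qp q (real k * (real D + e - real k)) = (B * E / X) ^ k"
    "qp q (real k * (real D + e - real k - 2) + real D + e) = (B * E / X / Q\<^sup>2) ^ k * B * E"
    "qp q (real k * (real D + e - real k - 1) + real D) = (B * E / X / Q) ^ k * B"
    "qp q (1 - real D) = Q / B" "qp q (e - real k) = E / X"
    "qp q (real D + e - 2 * real k) = B * E / (X * X)" "qp q (real D + e - real k) = B * E / X"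
    "qp q (real D - real k) = B / X" "qp q (real k - e) = X / E"
    "qp q (e - real k + 1) = E / X * Q"
    by (simp_all only: qp_simps mult_2 assms(3,4))
  have int: "int k \<noteq> 0" "int k \<noteq> - int D" "0 < int k" "- int k \<noteq> 0" "- int k \<noteq> - int D" "\<not> 0 < - int k"
    using assms D_ge_2 by auto
  have wp: "wt q D e (int k) = Z * ((1 - X / B) * (1 + B + B * E / X - B / X) / ((1 - X) * (1 + E / X)))"
  proof -
    have "wt q D e (int k) = (- 1) ^ k * (B * E / X) ^ k * qpoch (Q / B) Q k * (1 + B + B * E / X - B / X)
        / (qpoch Q Q k * qpoch (- (E / X)) Q D * m)"
      by (simp only: wt_def Let_def int if_False if_True nat_int qps m_def flip: Q_def assms(3))
    then show ?thesis
      using P1 S1 G1 by (simp add: Z_def mult_ac)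
  qed
  have wm: "wt q D e (- int k) = - (Z * (B * E * (1 + B + X / E - X) / (X * X * (1 + E * B / X))))"
  proof -
    have 1: "(B * E / X / Q\<^sup>2) ^ k = (B * E / X) ^ k / (X * X)"
      by (simp add: assms(4) power_divide power_mult_distrib power2_eq_square)
    have "wt q D e (- int k) = (- 1) ^ y * ((B * E / X / Q\<^sup>2) ^ k * B * E) * P * (1 + B + X / E - X)
        / (S * qpoch (- (E / X * Q)) Q D * m)"
      by (simp only: wt_def Let_def int if_False if_True nat_int qps m_def y P_def S_def minus_minus
            flip: Q_def assms(3,4))
    then show ?thesis
      using G2 unfolding 1 by (simp add: Z_def k mult_ac)
  qed
  have cw: "cwt q D e k = Z * (B * (1 - X / B) / X)"
  proof -
    have 1: "(B * E / X / Q) ^ k = (B * E / X) ^ k / X"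
      by (simp add: assms(4) power_divide power_mult_distrib)
    have "cwt q D e k = (- 1) ^ k * ((B * E / X / Q) ^ k * B) * qpoch (Q / B) Q k
        / (S * qpoch (- (E / X * Q)) Q n * m)"
      by (simp only: cwt_def Let_def qps m_def y n S_def flip: Q_def)
    then show ?thesis
      using P1 unfolding 1 by (simp add: Z_def G_def mult_ac)
  qed
  have "W k = Z * (m * m * X ^ 3 * (1 - 1 / B) / ((E + X) * (X + E * B) * (1 - X)))"
  proof -
    have T: "T = - 1 / (B * E)" by (simp add: T_def assms(3))
    have 1: "(B / T) ^ k / Q ^ (k * k) = (- 1) ^ k * (B * E / X) ^ k * B ^ k"
    proof -
      have "B / T = (- 1) * (B * E) * B"
        unfolding T using nz nz' by simp
      then have "(B / T) ^ k = (- 1) ^ k * (B * E) ^ k * B ^ k"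
        by (simp only: power_mult_distrib)
      moreover have "Q ^ (k * k) = X ^ k" by (simp add: assms(4) power_mult)
      ultimately show ?thesis
        by (simp only: power_divide times_divide_eq_left times_divide_eq_right)
    qed
    have 2: "qpoch (1 / B) Q k = (1 - 1 / B) * P"
      by (simp add: k qpoch_Suc_shift P_def)
    have 3: "G * qpoch T Q k * B ^ k * (E + X) * (X + E * B) = qpoch (- Q / E) Q k * M * X * (1 + E * B)"
      using qpoch_weight_quotient[OF assms(3,4)] by (simp add: G_def D)
    have 4: "1 - T * (X * X) = X * X / (B * E) * m" "1 - T = (1 + E * B) / (E * B)"
      unfolding T m_def using nz nz' by (simp_all add: field_simps)
    have R: "qpoch (- Q / E) Q k \<noteq> 0" by (rule qpoch_inv_E_nz)
    define R where "R = qpoch (- Q / E) Q k"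
    have "W k = qpoch T Q k * ((1 - 1 / B) * P) * (1 - T * (X * X)) * ((B / T) ^ k / Q ^ (k * k))
        / ((1 - T) * (S * (1 - X)) * R * M)"
      unfolding W_def qk_weight_def T_eqs assms(3)[symmetric] 2 S1 mult.commute[of 2] pows R_def
      by simp
    also have "\<dots> = (qpoch T Q k * B ^ k) / (R * M) * ((- 1) ^ k * (B * E / X) ^ k * (1 - 1 / B) * P * (X * X / (B * E) * m)
        / ((1 + E * B) / (E * B) * (S * (1 - X))))"
      unfolding 1 4 by (simp only: times_divide_eq_left times_divide_eq_right divide_divide_eq_left mult_ac)
    also have "(qpoch T Q k * B ^ k) / (R * M) = X * (1 + E * B) / (G * (E + X) * (X + E * B))"
      using 3 R nz2 sums unfolding R_def[symmetric] by (simp add: divide_simps mult_ac)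
    also have "\<dots> * ((- 1) ^ k * (B * E / X) ^ k * (1 - 1 / B) * P * (X * X / (B * E) * m)
        / ((1 + E * B) / (E * B) * (S * (1 - X))))
      = ((- 1) ^ k * (B * E / X) ^ k * P / (S * G * m)) * (m * m * X ^ 3 * (1 - 1 / B) / ((E + X) * (X + E * B) * (1 - X)))"
    proof (cases "m = 0")
      case False
      define u v w z where "u = 1 + E * B" and "v = E + X" and "w = X + E * B" and "z = 1 - X"
      define d where "d = 1 - 1 / B"
      define p where "p = (B * E / X) ^ k"
      have "u \<noteq> 0" "v \<noteq> 0" "w \<noteq> 0" "z \<noteq> 0"
        using sums X1 by (simp_all add: u_def v_def w_def z_def)
      then show ?thesis
        unfolding u_def[symmetric] v_def[symmetric] w_def[symmetric] z_def[symmetric] d_def[symmetric] p_def[symmetric]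
        using False nz nz' nz2 by (simp add: divide_simps power3_eq_cube)
    qed simp
    finally show ?thesis
      unfolding Z_def .
  qed
  then show ?thesis
    using wp wm cw that[of Z] unfolding m_def by simp
qed

text \<open>Two steps along the boundary identities: \<open>qk_bdry_lower\<close> leads from
  \<open>(T, D)\<close> at \<open>k\<close> to \<open>(T * Q, D - 1)\<close> at
  \<open>k - 1\<close>, and \<open>qk_bdry_upper\<close> from there to
  \<open>(T * Q ^ 2, D - 2)\<close> at \<open>k - 1\<close>.\<close>

lemma Wp_eq:
  assumes "1 \<le> k" "k \<le> D - 1" and "B = Q ^ D" "X = Q ^ k"
  shows "K * Wp k = - (W k * (1 - T * X) * (1 - X / B) * (1 - X) * (1 + X / E) * E * B / (X * X))"
proof -
  obtain y where k: "k = Suc y"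
    using assms(1) by (cases k) auto
  obtain n where D: "D = Suc (Suc n)"
    using D_ge_2 by (cases D; cases "D - 1") auto
  have nz': "B \<noteq> 0" "X \<noteq> 0" using assms nz by auto
  have QB: "Q ^ n = B / Q / Q" "Q ^ y = X / Q" "Q ^ (2 * y) = X / Q * (X / Q)"
    using assms(3,4) nz D k by (simp_all add: mult_2 power_add)
  have T: "T = - 1 / (B * E)" by (simp add: T_def assms(3))
  interpret g1: qk_generic Q "T * Q"
    using gen.shift[of 1] by simp
  define W1 W2 where "W1 = qk_weight Q (T * Q) (Suc n) y" and "W2 = qk_weight Q (T * Q ^ 2) n y"
  define h where "h = 1 - T * (X * X) / Q"
  define z where "z = 1 - T * (X * X)"
  have hz: "h \<noteq> 0" "z \<noteq> 0" "1 - T * Q \<noteq> 0" "1 - T * Q ^ 2 \<noteq> 0"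
    using gen.one_minus_T[of "Suc (2 * y)"] gen.one_minus_T[of "2 * k"] gen.one_minus_T[of 1] gen.one_minus_T[of 2] nz
    by (simp_all add: h_def z_def QB k mult_2 power_add)
  have b: "1 - 1 / B \<noteq> 0" "1 - Q / B \<noteq> 0"
    using Q_pow_ne_1[of D] gen.pow_inj[of 1 D] nz nz' D_ge_2 assms(3) by auto
  have l: "(1 - T * Q) * W1 * (X / Q) / h
      = qk_weight Q T D k * (T * X / B * (1 - X) * (1 - T * B * X) / ((1 - 1 / B) * z))"
  proof -
    have "T * Q ^ (Suc (Suc n) + Suc y) = T * B * X"
      using nz by (simp add: power_add QB)
    then show ?thesis
      using gen.qk_bdry_lower[of "Suc n" y] nz
      by (simp add: qk_bdry_def W1_def h_def z_def D k QB)
  qed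
  have u: "(1 - T * Q ^ 2) * W2 * (X / Q) / z
      = W1 * ((1 - T * X) * (1 - X / B) / (X / Q * (1 - Q / B) * h))"
    using g1.qk_bdry_upper[of n y] nz
    by (simp add: qk_bdry_def W1_def W2_def h_def z_def QB power2_eq_square mult.assoc)
  \<comment> \<open>The last two factors are the quotient of the total masses; up to monomials they
    are \<open>1 - T * Q ^ 2\<close> and \<open>1 - T * Q\<close>.\<close>
  have M: "M = qpoch (- E) Q n * (1 + E * B / Q / Q) * (1 + E * B / Q)"
    unfolding M_def using nz(1) by (simp add: D qpoch_Suc QB)
  have solve: "v * r * (X / Q) / g = s \<Longrightarrow> v \<noteq> 0 \<Longrightarrow> g \<noteq> 0 \<Longrightarrow> r = s * g * Q / (X * v)" for v r g s
    using nz' nz by (auto simp: field_simps)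
  have W1: "W1 = qk_weight Q T D k * (T * X / B * (1 - X) * (1 - T * B * X) / ((1 - 1 / B) * z)) * h * Q / (X * (1 - T * Q))"
    by (rule solve[OF l hz(3,1)])
  have W2: "W2 = W1 * ((1 - T * X) * (1 - X / B) / (X / Q * (1 - Q / B) * h)) * z * Q / (X * (1 - T * Q ^ 2))"
    by (rule solve[OF u hz(4,2)])
  define A2 where "A2 = qpoch (- E) Q n"
  have A2: "A2 \<noteq> 0" using qpoch_E_nz by (simp add: A2_def)
  define A3 A4 where "A3 = 1 + E * B / Q / Q" and "A4 = 1 + E * B / Q"
  have "M \<noteq> 0" using qpoch_E_nz by (simp add: M_def)
  then have A34: "A3 \<noteq> 0" "A4 \<noteq> 0"
    unfolding M A3_def A4_def by auto
  have t12: "1 - T * Q = Q / (E * B) * A4" "1 - T * Q ^ 2 = Q * Q / (E * B) * A3"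
    unfolding T A3_def A4_def using nz nz' by (simp_all add: field_simps power2_eq_square)
  have tbx: "1 - T * B * X = 1 + X / E"
    unfolding T using nz' by simp
  have kk: "K = B * (1 - 1 / B) * (1 - Q / B)"
    unfolding K_def using nz' assms(3)[symmetric] by (simp add: field_simps)
  define d1 d2 where "d1 = 1 - 1 / B" and "d2 = 1 - Q / B"
  define w where "w = qk_weight Q T D k"
  define f1 f2 f3 f4 where "f1 = 1 - X" and "f2 = 1 + X / E" and "f3 = 1 - T * X" and "f4 = 1 - X / B"
  have W2': "W2 = (w * (T * X / B * f1 * f2 / (d1 * z)) * h * Q / (X * (Q / (E * B) * A4)))
       * (f3 * f4 / (X / Q * d2 * h)) * z * Q / (X * (Q * Q / (E * B) * A3))"
    unfolding W2 W1 t12 tbx d1_def d2_def w_def f1_def f2_def f3_def f4_def ..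
  have "K * Wp k = B * d1 * d2 * (W2 / A2)"
    unfolding kk d1_def d2_def Wp_def W2_def A2_def by (simp add: D k)
  also have "\<dots> = B * d1 * d2 * (w * f1 * f2 * f3 * f4 * T * (E * B) * (E * B) / (B * d1 * d2 * X * X * A3 * A4) / A2)"
    unfolding W2' using hz nz nz' A34 by (simp add: field_simps)
  also have "\<dots> = - (w / (A2 * A3 * A4) * f3 * f4 * f1 * f2 * E * B / (X * X))"
    using b[folded d1_def d2_def] nz nz' A34 A2 unfolding T by (simp add: field_simps)
  finally show ?thesis
    unfolding W_def M w_def f1_def f2_def f3_def f4_def A2_def A3_def A4_def .
qed

lemma weight_relations:
  assumes "1 \<le> k" "k \<le> D - 1"
  shows "wt q D e (int k) + wt q D e (- int k) + 2 * cwt q D e k = W k"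
    and "Pp k * (wt q D e (int k) + cwt q D e k) + Pm k * (wt q D e (- int k) + cwt q D e k) = 0"
    and "- ((Pp k)\<^sup>2 * wt q D e (int k) + (Pm k)\<^sup>2 * wt q D e (- int k) + 2 * Pp k * Pm k * cwt q D e k) = K * Wp k"
proof -
  define B X where "B = Q ^ D" and "X = Q ^ k"
  obtain Z where Z:
    "wt q D e (int k) = Z * ((1 - X / B) * (1 + B + B * E / X - B / X) / ((1 - X) * (1 + E / X)))"
    "wt q D e (- int k) = - (Z * (B * E * (1 + B + X / E - X) / (X * X * (1 + E * B / X))))"
    "cwt q D e k = Z * (B * (1 - X / B) / X)"
    "W k = Z * ((1 + B * E / (X * X)) * (1 + B * E / (X * X)) * X ^ 3 * (1 - 1 / B) / ((E + X) * (X + E * B) * (1 - X)))"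
    using weights_common_factor[OF assms B_def X_def] by blast
  have nz': "B \<noteq> 0" "X \<noteq> 0" using nz by (auto simp: B_def X_def)
  have sums: "E + X \<noteq> 0" "X + E * B \<noteq> 0" "1 - X \<noteq> 0"
    using E_pow_nz[of 0 k] E_pow_nz[of D k] Q_pow_ne_1[of k] assms by (simp_all add: X_def B_def add.commute)
  define a b c where "a = E + X" and "b = X + E * B" and "c = 1 - X"
  have abc: "a \<noteq> 0" "b \<noteq> 0" "c \<noteq> 0" using sums by (simp_all add: a_def b_def c_def)
  have wp: "wt q D e (int k) = Z / (a * b * c) * ((B - X) * (X + B * X + B * E - B) * b / B)"
  proof -
    have "1 + E / X = a / X" "1 - X / B = (B - X) / B"
      "1 + B + B * E / X - B / X = (X + B * X + B * E - B) / X"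
      using nz' by (simp_all add: a_def field_simps)
    then show ?thesis
      unfolding Z c_def[symmetric] using abc nz' by simp
  qed
  have wm: "wt q D e (- int k) = Z / (a * b * c) * (- (B * (E + B * E + X - X * E) * a * c / X))"
  proof -
    have "1 + E * B / X = b / X" "1 + B + X / E - X = (E + B * E + X - X * E) / E"
      using nz nz' by (simp_all add: b_def field_simps)
    then show ?thesis
      unfolding Z using abc nz nz' by simp
  qed
  have cw: "cwt q D e k = Z / (a * b * c) * ((B - X) * a * b * c / X)"
    unfolding Z using abc nz' by (simp add: field_simps)
  have Wk: "W k = Z / (a * b * c) * ((X * X + B * E) * (X * X + B * E) * (B - 1) / (X * B))"
  proof -
    have "1 + B * E / (X * X) = (X * X + B * E) / (X * X)" "1 - 1 / B = (B - 1) / B"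
      using nz' by (simp_all add: field_simps)
    then show ?thesis
      unfolding Z a_def[symmetric] b_def[symmetric] c_def[symmetric]
      using abc nz' by (simp add: power3_eq_cube)
  qed
  have T: "T = - 1 / (B * E)" by (simp add: T_def B_def)
  have Pp: "Pp k = c * a / (B * E * X) / t"
    unfolding Pp_def B_def[symmetric] X_def[symmetric] T a_def c_def using nz nz' by (simp add: field_simps)
  have Pm: "Pm k = b * (B - X) / (B * B * E * X) / t"
    unfolding Pm_def B_def[symmetric] X_def[symmetric] T b_def using nz nz' by (simp add: field_simps)
  have tt: "t\<^sup>2 = - 1 / (B * E)"
    using t_square T by (simp add: power2_eq_square)
  have 1: "(B - X) * (X + B * X + B * E - B) * b / B + - (B * (E + B * E + X - X * E) * a * c / X)
      + 2 * ((B - X) * a * b * c / X) = (X * X + B * E) * (X * X + B * E) * (B - 1) / (X * B)"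
    unfolding a_def b_def c_def using nz' by (simp add: divide_simps) (simp add: algebra_simps)
  show "wt q D e (int k) + wt q D e (- int k) + 2 * cwt q D e k = W k"
    unfolding wp wm cw Wk 1[symmetric] by (simp add: algebra_simps)
  define w w' c' s d z where "w = wt q D e (int k)" and "w' = wt q D e (- int k)" and "c' = cwt q D e k"
    and "s = Pp k * (w + c')" and "d = Pp k - Pm k" and "z = Z / (a * b * c)"
  \<comment> \<open>\<open>g\<close> is the common factor of \<open>w + c'\<close>,
    \<open>w' + c'\<close> and \<open>d\<close>.\<close>
  define g where "g = X * X + B * E"
  have "(B - X) * (X + B * X + B * E - B) * b / B + (B - X) * a * b * c / X = (B - X) * b * g / (B * X)"
    unfolding a_def c_def g_def using nz' by (simp add: divide_simps) (simp add: algebra_simps)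
  then have wc: "w + c' = z * ((B - X) * b * g / (B * X))"
    unfolding w_def c'_def wp cw z_def by (metis distrib_left)
  have "- (B * (E + B * E + X - X * E) * a * c / X) + (B - X) * a * b * c / X = - (a * c * g / X)"
    unfolding b_def g_def using nz' by (simp add: divide_simps) (simp add: algebra_simps)
  then have wc': "w' + c' = z * (- (a * c * g / X))"
    unfolding w'_def c'_def wm cw z_def by (metis distrib_left)
  have s: "s = z * (a * b * c * (B - X) * g / (B * B * E * X * X * t))"
    unfolding s_def wc Pp by (simp add: mult_ac)
  have s': "Pm k * (w' + c') = - s"
    unfolding s wc' Pm by (simp add: mult_ac)
  then show "Pp k * (wt q D e (int k) + cwt q D e k) + Pm k * (wt q D e (- int k) + cwt q D e k) = 0"
    by (simp add: s_def w_def w'_def c'_def)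
  have "c * a * B - b * (B - X) = (1 - B) * g"
    unfolding a_def b_def c_def g_def by (simp add: algebra_simps)
  moreover have "d = (c * a * B - b * (B - X)) / (B * B * E * X * t)"
    unfolding d_def Pp Pm using nz nz' by (simp add: diff_divide_distrib)
  ultimately have d: "d = (1 - B) * g / (B * B * E * X * t)"
    by simp
  have c': "c' = z * ((B - X) * a * b * c / X)"
    unfolding c'_def cw z_def ..
  have "s - c' * d = z * (a * b * c) * ((B - X) * g * (1 - (1 - B)) / (B * B * E * X * X * t))"
    unfolding s c' d by (simp add: right_diff_distrib left_diff_distrib diff_divide_distrib mult_ac)
  then have sd: "s - c' * d = Z * ((B - X) * g / (B * E * X * X * t))"
    using abc nz' by (simp add: z_def)
  \<comment> \<open>Substituting \<open>Pp k * (w + c') = s\<close> and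
    \<open>Pm k * (w' + c') = - s\<close> eliminates \<open>w\<close> and \<open>w'\<close>, and the
    quadratic expression factorises.\<close>
  have "(Pp k)\<^sup>2 * w + (Pm k)\<^sup>2 * w' + 2 * Pp k * Pm k * c' = d * (s - c' * d)"
    using s' unfolding s_def d_def by algebra
  also have "\<dots> = (1 - B) * g * Z * (B - X) * g / (B * B * B * E * E * X * X * X * t\<^sup>2)"
    unfolding sd unfolding d by (simp add: power2_eq_square mult_ac)
  also have "\<dots> = Z * g * g * (B - 1) * (B - X) / (B * B * E * X * X * X)"
    unfolding tt using nz nz' by (simp add: field_simps)
  also have "\<dots> = W k * (1 - T * X) * (1 - X / B) * (1 - X) * (1 + X / E) * E * B / (X * X)"
  proof -
    have "1 - T * X = b / (B * E)" "1 - X / B = (B - X) / B" "1 + X / E = a / E"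
      unfolding T a_def b_def using nz nz' by (simp_all add: field_simps)
    then show ?thesis
      unfolding Wk c_def[symmetric] g_def[symmetric] using abc nz nz' by (simp add: mult_ac)
  qed
  finally show "- ((Pp k)\<^sup>2 * wt q D e (int k) + (Pm k)\<^sup>2 * wt q D e (- int k) + 2 * Pp k * Pm k * cwt q D e k) = K * Wp k"
    unfolding Wp_eq[OF assms B_def X_def] w_def w'_def c'_def by simp
qed

lemma Q_pow_D: "Q ^ D = Q\<^sup>2 * Q ^ (D - 2)"
  using D_ge_2 by (metis le_add_diff_inverse power_add)

section \<open>Orthogonality of the functions \<open>\<ell>\<^sub>i\<^sup>\<plusminus>\<close>\<close>

text \<open>The factor \<open>T ^ n\<close> of \<open>qk_orthogonality\<close> is
  \<open>t ^ n * t ^ n\<close> and cancels the scaling in \<open>H\<close>, the total mass cancels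
  \<open>M\<close>, and conjugating the imaginary \<open>t\<close> produces the sign.\<close>

lemma sum_W:
  assumes "n \<le> D" "m \<le> D"
  shows "(\<Sum>x\<le>D. W x * (H n x * cnj (H m x)))
    = (if n = m then (- 1) ^ n * qpoch (1 / Q ^ D) Q n * qpoch Q Q n else 0)"
proof -
  define a where "a n = qpoch (1 / Q ^ D) Q n" for n
  have M: "M \<noteq> 0" using qpoch_E_nz by (simp add: M_def)
  have cH: "cnj (H m x) = a m / (- t) ^ m * qk Q T D m x" for x
    by (simp add: H_def a_def cnj_qpoch cnj_qk cnj_real)
  have "(\<Sum>x\<le>D. W x * (H n x * cnj (H m x)))
     = a n / t ^ n * (a m / (- t) ^ m) / M * (\<Sum>x\<le>D. qk_weight Q T D x * qk Q T D n x * qk Q T D m x)"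
    unfolding cH unfolding H_def W_def a_def[symmetric] by (simp add: sum_distrib_left mult_ac)
  also have "\<dots> = (if n = m then (- 1) ^ n * a n * qpoch Q Q n else 0)"
  proof (cases "n = m")
    case True
    have "T ^ n = t ^ n * t ^ n"
      by (simp flip: t_square power_mult_distrib)
    moreover have "(- t) ^ n = (- 1) ^ n * t ^ n"
      by (simp flip: power_mult_distrib)
    moreover have "a n \<noteq> 0"
      unfolding a_def using gen.qpoch_inverse_pow_nz assms by simp
    ultimately show ?thesis
      using M nz True unfolding qk_orthogonality[OF generic assms] T_eqs(2) M_def[symmetric] a_def[symmetric]
      by (simp add: field_simps)
  qed (simp add: qk_orthogonality[OF generic assms])
  finally show ?thesis
    unfolding a_def .
qed

lemma sum_Wp:
  assumes "n \<le> D - 2" "m \<le> D - 2"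
  shows "(\<Sum>k\<in>{1..D - 1}. Wp k * (Hp n k * cnj (Hp m k)))
    = (if n = m then (- 1) ^ n * qpoch (1 / Q ^ (D - 2)) Q n * qpoch Q Q n else 0)"
proof -
  define a where "a n = qpoch (1 / Q ^ (D - 2)) Q n" for n
  define M2 where "M2 = qpoch (- E) Q (D - 2)"
  define F where "F x = qk_weight Q (T * Q ^ 2) (D - 2) x * qk Q (T * Q ^ 2) (D - 2) n x * qk Q (T * Q ^ 2) (D - 2) m x" for x
  have M: "M2 \<noteq> 0" using qpoch_E_nz by (simp add: M2_def)
  have cH: "cnj (Hp m x) = a m / (- (t * Q)) ^ m * qk Q (T * Q ^ 2) (D - 2) m (x - 1)" for x
    by (simp add: Hp_def a_def cnj_qpoch cnj_qk cnj_real)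
  have gen2: "qk_generic Q (T * Q ^ 2)"
    by (rule gen.shift)
  have TE: "1 / (T * Q ^ 2 * Q ^ (D - 2)) = - E"
    using nz by (simp add: T_def Q_pow_D)
  have "(\<Sum>k\<in>{1..D - 1}. Wp k * (Hp n k * cnj (Hp m k)))
     = (\<Sum>k\<in>{1..D - 1}. a n / (t * Q) ^ n * (a m / (- (t * Q)) ^ m) / M2 * F (k - 1))"
    unfolding cH unfolding Hp_def Wp_def a_def[symmetric] M2_def[symmetric] F_def by (simp add: mult_ac)
  also have "\<dots> = (\<Sum>x\<le>D - 2. a n / (t * Q) ^ n * (a m / (- (t * Q)) ^ m) / M2 * F x)"
    by (rule sum.reindex_bij_witness[of _ Suc "\<lambda>k. k - 1"]) (use D_ge_2 in auto)
  also have "\<dots> = a n / (t * Q) ^ n * (a m / (- (t * Q)) ^ m) / M2 * (\<Sum>x\<le>D - 2. F x)"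
    by (simp add: sum_distrib_left)
  also have "\<dots> = (if n = m then (- 1) ^ n * a n * qpoch Q Q n else 0)"
  proof (cases "n = m")
    case True
    have "(T * Q ^ 2) ^ n = (t * Q) ^ n * (t * Q) ^ n"
      by (simp add: power2_eq_square mult_ac flip: t_square power_mult_distrib)
    moreover have "(- (t * Q)) ^ n = (- 1) ^ n * (t * Q) ^ n"
      by (simp flip: power_mult_distrib)
    moreover have "a n \<noteq> 0"
      unfolding a_def using gen.qpoch_inverse_pow_nz assms by simp
    moreover have "(t * Q) ^ n \<noteq> 0"
      using nz by simp
    moreover define p where "p = (t * Q) ^ n"
    ultimately show ?thesis
      using M True
      unfolding F_def qk_orthogonality[OF gen2 assms] TE a_def[symmetric] M2_def[symmetric] p_def[symmetric]
      by (simp add: field_simps)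
  qed (simp add: qk_orthogonality[OF gen2 assms] F_def)
  finally show ?thesis
    unfolding a_def .
qed

text \<open>The values of \<open>a h\<^sub>n + b p\<^sup>\<bottom> h\<^sub>m\<^sup>\<bottom>\<close> at all the nodes.\<close>

definition node_rep :: "(complex \<Rightarrow> complex) \<Rightarrow> complex \<Rightarrow> nat \<Rightarrow> complex \<Rightarrow> nat \<Rightarrow> bool" where
  "node_rep f a n b m \<longleftrightarrow>
     f (lam q D e 0) = a * H n 0 \<and> f (lam q D e (- int D)) = a * H n D \<and>
     (\<forall>k\<in>{1..D - 1}. f (lam q D e (int k)) = a * H n k + Pp k * (b * Hp m k) \<and>
                      f (lam q D e (- int k)) = a * H n k + Pm k * (b * Hp m k))"

definition norm_H :: "nat \<Rightarrow> complex" where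
  "norm_H n = (- 1) ^ n * qpoch (1 / Q ^ D) Q n * qpoch Q Q n"

text \<open>The factor \<open>K\<close> accounts for \<open>pperp\<close>: this is the squared norm
  of the product of \<open>pperp\<close> and \<open>hperp\<close>.\<close>

definition norm_Hp :: "nat \<Rightarrow> complex" where
  "norm_Hp n = K * ((- 1) ^ n * qpoch (1 / Q ^ (D - 2)) Q n * qpoch Q Q n)"

text \<open>Conjugation negates the imaginary values of \<open>pperp\<close>. On each pair of nodes
  the form therefore splits into three parts, one for each of the \<open>weight_relations\<close>,
  and the mixed part vanishes.\<close>

lemma ipL_node_rep:
  assumes f: "node_rep f a n b m" and g: "node_rep g a' n' b' m'"
    and "n \<le> D" "n' \<le> D" "m \<le> D - 2" "m' \<le> D - 2"
  shows "ipL q D e f g = a * cnj a' * (if n = n' then norm_H n else 0)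
                       + b * cnj b' * (if m = m' then norm_Hp m else 0)"
proof -
  define F where "F k = W k * (H n k * cnj (H n' k))" for k
  define G where "G k = Wp k * (Hp m k * cnj (Hp m' k))" for k
  define V where "V i = f (lam q D e i) * cnj (g (lam q D e i)) * wt q D e i" for i
  have pair: "V (int k) + V (- int k) + (f (lam q D e (int k)) * cnj (g (lam q D e (- int k)))
         + f (lam q D e (- int k)) * cnj (g (lam q D e (int k)))) * cwt q D e k
       = a * cnj a' * F k + b * cnj b' * (K * G k)" if k: "k \<in> {1..D - 1}" for k
  proof -
    have k': "1 \<le> k" "k \<le> D - 1" using k by auto
    define w w' c p p' where "w = wt q D e (int k)" and "w' = wt q D e (- int k)" and "c = cwt q D e k"
      and "p = Pp k" and "p' = Pm k"
    define A A' B B' where "A = a * H n k" and "A' = cnj (a' * H n' k)"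
      and "B = b * Hp m k" and "B' = cnj (b' * Hp m' k)"
    have fv: "f (lam q D e (int k)) = A + p * B" "f (lam q D e (- int k)) = A + p' * B"
      using f k by (auto simp: node_rep_def A_def B_def p_def p'_def)
    have gv: "cnj (g (lam q D e (int k))) = A' - p * B'" "cnj (g (lam q D e (- int k))) = A' - p' * B'"
      using g k by (auto simp: node_rep_def A'_def B'_def p_def p'_def cnj_Pp cnj_Pm)
    have 1: "w + w' + 2 * c = W k" "p * (w + c) + p' * (w' + c) = 0"
      "- (p\<^sup>2 * w + p'\<^sup>2 * w' + 2 * p * p' * c) = K * Wp k"
      unfolding w_def w'_def c_def p_def p'_def by (rule weight_relations[OF k'])+
    have "V (int k) + V (- int k) + (f (lam q D e (int k)) * cnj (g (lam q D e (- int k)))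
         + f (lam q D e (- int k)) * cnj (g (lam q D e (int k)))) * cwt q D e k
      = A * A' * (w + w' + 2 * c) + (B * A' - A * B') * (p * (w + c) + p' * (w' + c))
         + B * B' * (- (p\<^sup>2 * w + p'\<^sup>2 * w' + 2 * p * p' * c))"
      unfolding V_def fv gv w_def[symmetric] w'_def[symmetric] c_def[symmetric]
      by (simp add: algebra_simps power2_eq_square)
    also have "\<dots> = a * cnj a' * F k + b * cnj b' * (K * G k)"
      unfolding 1 F_def G_def A_def A'_def B_def B'_def by (simp add: mult_ac)
    finally show ?thesis .
  qed
  have ends: "V 0 = a * cnj a' * F 0" "V (- int D) = a * cnj a' * F D"
    using f g unfolding V_def F_def wt_0 wt_minus_D node_rep_def by (simp_all add: mult_ac)
  have "(\<Sum>i\<in>{- int D..int D - 1}. V i) = V 0 + V (- int D) + (\<Sum>k\<in>{1..D - 1}. V (int k) + V (- int k))"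
    using sum_pairs_int[of V "D - 1"] D_ge_2 by (simp add: of_nat_diff)
  then have "ipL q D e f g = V 0 + V (- int D) +
     (\<Sum>k\<in>{1..D - 1}. V (int k) + V (- int k) + (f (lam q D e (int k)) * cnj (g (lam q D e (- int k)))
         + f (lam q D e (- int k)) * cnj (g (lam q D e (int k)))) * cwt q D e k)"
    unfolding ipL_def V_def[symmetric] by (simp only: sum.distrib add.assoc)
  also have "(\<Sum>k\<in>{1..D - 1}. V (int k) + V (- int k) + (f (lam q D e (int k)) * cnj (g (lam q D e (- int k)))
         + f (lam q D e (- int k)) * cnj (g (lam q D e (int k)))) * cwt q D e k)
     = (\<Sum>k\<in>{1..D - 1}. a * cnj a' * F k + b * cnj b' * (K * G k))"
    by (rule sum.cong[OF refl pair])
  also have "V 0 + V (- int D) + \<dots>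
      = a * cnj a' * (F 0 + F D + (\<Sum>k\<in>{1..D - 1}. F k)) + b * cnj b' * (K * (\<Sum>k\<in>{1..D - 1}. G k))"
    unfolding ends by (simp add: sum.distrib sum_distrib_left distrib_left)
  \<comment> \<open>The two unpaired nodes supply the end points of the Krawtchouk grid.\<close>
  also have "F 0 + F D + (\<Sum>k\<in>{1..D - 1}. F k) = (\<Sum>x\<le>D. F x)"
  proof -
    have "{..D} = insert 0 (insert D {1..D - 1})" using D_ge_2 by auto
    then show ?thesis using D_ge_2 by simp
  qed
  also have "(\<Sum>x\<le>D. F x) = (if n = n' then norm_H n else 0)"
    unfolding F_def norm_H_def sum_W[OF assms(3,4)] ..
  also have "K * (\<Sum>k\<in>{1..D - 1}. G k) = (if m = m' then norm_Hp m else 0)"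
    unfolding G_def norm_Hp_def sum_Wp[OF assms(5,6)] by simp
  finally show ?thesis .
qed

section \<open>Coefficients and norms of the functions \<open>ell\<close>\<close>

definition plus_coeff :: "nat \<Rightarrow> complex" where
  "plus_coeff i = 1 / (t ^ (i + 1) * (1 - Q ^ D) * qpoch Q Q i)"

definition minus_coeff :: "nat \<Rightarrow> complex" where
  "minus_coeff i = (Q ^ D - Q ^ i) / (t ^ i * (Q ^ D - 1) * qpoch Q Q i)"

definition perp_ratio :: "nat \<Rightarrow> complex" where
  "perp_ratio i = (1 - Q ^ i) / (Q ^ D - Q ^ i)"

lemma ell_True: "ell q D e True i x = plus_coeff i * hh q D e (i + 1) x - plus_coeff i * (pperp q D e x * hperp q D e (int i) x)"
  by (simp add: ell_def plus_coeff_def Q_def t_def diff_divide_distrib)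

lemma ell_False: "ell q D e False i x
  = minus_coeff i * hh q D e i x - minus_coeff i * perp_ratio i * (pperp q D e x * hperp q D e (int i - 1) x)"
  by (simp only: ell_def minus_coeff_def perp_ratio_def Q_def t_def if_False right_diff_distrib mult.assoc)

lemma pperp_ends: "pperp q D e (lam q D e 0) = 0" "pperp q D e (lam q D e (- int D)) = 0"
  using pperp_lam[of 0] pperp_lam_neg[of D] D_ge_2 by (simp_all add: Pp_0 Pm_D)

lemma hh_ends: "hh q D e i (lam q D e 0) = H i 0" "hh q D e i (lam q D e (- int D)) = H i D"
  using hh_lam[of i 0] hh_lam_neg[of D i] D_ge_2 by simp_all

lemma node_rep_plus:
  "i \<le> D - 2 \<Longrightarrow> node_rep (ell q D e True i) (plus_coeff i) (i + 1) (- plus_coeff i) i"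
  unfolding node_rep_def ell_True pperp_ends hh_ends
  by (auto simp: hh_lam hh_lam_neg pperp_lam pperp_lam_neg hperp_lam hperp_lam_neg)

text \<open>By \<open>hperp_top\<close> there is no second component; the index 0 beside the zero
  coefficient is a placeholder within the range that \<open>ipL_node_rep\<close> asks for.\<close>

lemma node_rep_plus_top: "node_rep (ell q D e True (D - 1)) (plus_coeff (D - 1)) D 0 0"
proof -
  have "D - 1 + 1 = D" "int (D - 1) = int D - 1" using D_ge_2 by auto
  then show ?thesis
    unfolding node_rep_def ell_True pperp_ends hh_ends
    by (auto simp: hh_lam hh_lam_neg hperp_top)
qed

lemma node_rep_minus:
  "i \<le> D - 2 \<Longrightarrow> node_rep (ell q D e False (Suc i)) (minus_coeff (Suc i)) (Suc i) (- minus_coeff (Suc i) * perp_ratio (Suc i)) i"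
  unfolding node_rep_def ell_False pperp_ends hh_ends
  by (auto simp: hh_lam hh_lam_neg pperp_lam pperp_lam_neg hperp_lam hperp_lam_neg)

lemma node_rep_minus_0: "node_rep (ell q D e False 0) (minus_coeff 0) 0 0 0"
  unfolding node_rep_def ell_False pperp_ends hh_ends
  by (auto simp: hh_lam hh_lam_neg hperp_def)

lemma NN_eq: "NN q D e s i = E ^ (if s then i + 1 else i) * (- (Q ^ D)) ^ i * qpoch (Q / Q ^ D) Q i / qpoch Q Q i"
proof -
  have "qp q ((if s then real i + 1 else real i) * e) = E ^ (if s then i + 1 else i)"
    using qp_of_nat_mult[OF q_pos, of "if s then i + 1 else i" e] by (auto simp: E_def add_ac)
  moreover have "(\<Prod>n\<in>{1..i}. (Q ^ D - Q ^ n) / (Q ^ n - 1)) = (- (Q ^ D)) ^ i * qpoch (Q / Q ^ D) Q i / qpoch Q Q i"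
  proof (induction i)
    case (Suc i)
    have "(Q ^ D - Q ^ Suc i) / (Q ^ Suc i - 1) = - (Q ^ D) * (1 - Q / Q ^ D * Q ^ i) / (1 - Q * Q ^ i)"
      using nz Q_pow_ne_1[of "Suc i"] by (simp add: divide_simps) (simp add: algebra_simps)
    then show ?case
      using Suc.IH by (simp add: qpoch_Suc)
  qed simp
  ultimately show ?thesis
    by (simp add: NN_def Q_def)
qed

lemma t_norm: "t ^ i * (- t) ^ i = (1 / (Q ^ D * E)) ^ i"
  by (simp add: t_square T_def flip: power_mult_distrib)

text \<open>The factor \<open>Q ^ D - Q\<close> of \<open>K\<close> shifts the base
  \<open>1 / Q ^ (D - 2)\<close> to \<open>Q / Q ^ D\<close>, so that the Pochhammer products agree
  with those in \<open>norm_H_Suc\<close> and \<open>NN_eq\<close>.\<close>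

lemma norm_Hp_eq: "norm_Hp i = (1 - 1 / Q ^ D) * (- 1) ^ i * (Q ^ D - Q ^ Suc i) * qpoch (Q / Q ^ D) Q i * qpoch Q Q i"
proof -
  have "Q / Q ^ D * Q = 1 / Q ^ (D - 2)"
    using nz by (simp add: Q_pow_D power2_eq_square)
  then have "(1 - Q / Q ^ D) * qpoch (1 / Q ^ (D - 2)) Q i = qpoch (Q / Q ^ D) Q i * (1 - Q / Q ^ D * Q ^ i)"
    using qpoch_shift[of "Q / Q ^ D" Q i] by simp
  moreover have "Q ^ D - Q = Q ^ D * (1 - Q / Q ^ D)" "Q ^ D - Q ^ Suc i = Q ^ D * (1 - Q / Q ^ D * Q ^ i)"
    using nz by (simp_all add: field_simps)
  ultimately show ?thesis
    by (simp add: norm_Hp_def K_def mult_ac)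
qed

lemma norm_H_Suc: "norm_H (Suc i) = - ((1 - 1 / Q ^ D) * (- 1) ^ i * (1 - Q ^ Suc i) * qpoch (Q / Q ^ D) Q i * qpoch Q Q i)"
  by (simp add: norm_H_def qpoch_Suc_shift[of "1 / Q ^ D"] qpoch_Suc[of Q] mult_ac)

lemma cnj_plus_coeff: "cnj (plus_coeff i) = 1 / ((- t) ^ (i + 1) * (1 - Q ^ D) * qpoch Q Q i)"
  and cnj_minus_coeff: "cnj (minus_coeff i) = (Q ^ D - Q ^ i) / ((- t) ^ i * (Q ^ D - 1) * qpoch Q Q i)"
  and cnj_perp_ratio: "cnj (perp_ratio i) = perp_ratio i"
  by (simp_all add: plus_coeff_def minus_coeff_def perp_ratio_def cnj_qpoch cnj_real)

text \<open>The two norms share a factor, and \<open>(B - X) - (1 - X) = B - 1\<close> with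
  \<open>X = Q ^ Suc i\<close> removes the dependence on \<open>X\<close>.\<close>

lemma norm_plus: "plus_coeff i * cnj (plus_coeff i) * (norm_H (Suc i) + norm_Hp i) = NN q D e True i"
proof -
  define B S R where "B = Q ^ D" and "S = qpoch Q Q i" and "R = qpoch (Q / B) Q i"
  have nz': "B \<noteq> 0" "S \<noteq> 0" "B - 1 \<noteq> 0"
    using nz gen.qpoch_q_nz Q_pow_ne_1[of D] D_ge_2 by (auto simp: B_def S_def)
  have 1: "norm_H (Suc i) + norm_Hp i = (1 - 1 / B) * (- 1) ^ i * (B - 1) * R * S"
  proof -
    define d X where "d = 1 - 1 / B" and "X = Q ^ Suc i"
    show ?thesis
      unfolding norm_H_Suc norm_Hp_eq B_def[symmetric] S_def[symmetric] R_def[symmetric] d_def[symmetric] X_def[symmetric]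
      by (simp add: algebra_simps)
  qed
  have 2: "plus_coeff i * cnj (plus_coeff i) = (B * E) ^ (i + 1) / ((B - 1) * (B - 1) * S * S)"
  proof -
    have "plus_coeff i * cnj (plus_coeff i) = 1 / ((t ^ (i + 1) * (- t) ^ (i + 1)) * ((1 - B) * (1 - B)) * S * S)"
      unfolding cnj_plus_coeff unfolding plus_coeff_def B_def S_def by (simp add: mult_ac)
    also have "(1 - B) * (1 - B) = (B - 1) * (B - 1)" by (simp add: algebra_simps)
    finally show ?thesis
      unfolding t_norm B_def[symmetric] by (simp add: power_one_over power_divide mult.assoc)
  qed
  have 3: "1 - 1 / B = (B - 1) / B" using nz' by (simp add: field_simps)
  have 4: "(- B) ^ i = (- 1) ^ i * B ^ i" by (simp flip: power_mult_distrib)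
  show ?thesis
    unfolding 1 2 NN_eq 3 B_def[symmetric] S_def[symmetric] R_def[symmetric] 4
    using nz' by (simp add: power_mult_distrib)
qed

lemma norm_minus: 
  assumes "Suc i \<le> D - 1"
  shows "minus_coeff (Suc i) * cnj (minus_coeff (Suc i)) * (norm_H (Suc i) + perp_ratio (Suc i) * perp_ratio (Suc i) * norm_Hp i) = NN q D e False (Suc i)"
proof -
  define B S R X where "B = Q ^ D" and "S = qpoch Q Q i" and "R = qpoch (Q / B) Q i" and "X = Q ^ Suc i"
  have nz': "B \<noteq> 0" "S \<noteq> 0" "B - 1 \<noteq> 0" "1 - X \<noteq> 0" "B - X \<noteq> 0"
    using nz gen.qpoch_q_nz Q_pow_ne_1[of D] Q_pow_ne_1[of "Suc i"] gen.pow_inj[of D "Suc i"] D_ge_2 assms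
    by (auto simp: B_def S_def X_def simp del: power_Suc)
  have S: "qpoch Q Q (Suc i) = S * (1 - X)"
    by (simp add: S_def X_def qpoch_Suc)
  have R: "qpoch (Q / B) Q (Suc i) = R * ((B - X) / B)"
    using nz' by (simp add: R_def X_def qpoch_Suc diff_divide_distrib)
  have g: "perp_ratio (Suc i) = (1 - X) / (B - X)" by (simp add: perp_ratio_def B_def X_def)
  have 1: "norm_H (Suc i) + perp_ratio (Suc i) * perp_ratio (Suc i) * norm_Hp i
     = - ((1 - 1 / B) * (- 1) ^ i * (1 - X) * R * S * ((B - 1) / (B - X)))"
  proof -
    have r: "(B - 1) / (B - X) = 1 - (1 - X) / (B - X)" using nz' by (simp add: field_simps)
    have "perp_ratio (Suc i) * perp_ratio (Suc i) * norm_Hp i = (1 - 1 / B) * (- 1) ^ i * (1 - X) * R * S * ((1 - X) / (B - X))"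
      unfolding norm_Hp_eq g B_def[symmetric] S_def[symmetric] R_def[symmetric] X_def[symmetric]
      using nz' by simp
    then show ?thesis
      unfolding r norm_H_Suc B_def[symmetric] S_def[symmetric] R_def[symmetric] X_def[symmetric]
      by (simp add: right_diff_distrib)
  qed
  have 2: "minus_coeff (Suc i) * cnj (minus_coeff (Suc i)) = (B * E) ^ Suc i * (B - X) * (B - X) / ((B - 1) * (B - 1) * (S * (1 - X)) * (S * (1 - X)))"
  proof -
    have "minus_coeff (Suc i) * cnj (minus_coeff (Suc i)) = (B - X) * (B - X) / ((t ^ Suc i * (- t) ^ Suc i) * ((B - 1) * (B - 1)) * (S * (1 - X)) * (S * (1 - X)))"
      unfolding cnj_minus_coeff unfolding minus_coeff_def B_def[symmetric] X_def[symmetric] S by (simp add: mult_ac)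
    then show ?thesis
      unfolding t_norm B_def[symmetric] by (simp add: power_one_over power_divide mult_ac)
  qed
  have 3: "1 - 1 / B = (B - 1) / B" using nz' by (simp add: field_simps)
  have 4: "(- B) ^ Suc i = - ((- 1) ^ i * B ^ Suc i)" by (simp flip: power_mult_distrib)
  show ?thesis
    unfolding 1 2 NN_eq 3 R S B_def[symmetric] 4
    using nz' by (simp add: power_mult_distrib)
qed

text \<open>The plus function of index \<open>i\<close> and the minus function of index
  \<open>Suc i\<close> live on the same \<open>H (Suc i)\<close> and \<open>Hp i\<close>;
  \<open>perp_ratio\<close> is the constant that makes them orthogonal.\<close>

lemma norm_cross:
  assumes "Suc i \<le> D - 1"
  shows "norm_H (Suc i) + perp_ratio (Suc i) * norm_Hp i = 0"
proof -
  have "Q ^ D - Q ^ Suc i \<noteq> 0"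
    using gen.pow_inj[of D "Suc i"] assms by (auto simp del: power_Suc)
  then show ?thesis
    unfolding norm_H_Suc norm_Hp_eq perp_ratio_def by (simp del: power_Suc)
qed

text \<open>This lets \<open>norm_plus\<close> serve for \<open>i = D - 1\<close>, where the second
  component is absent.\<close>

lemma norm_Hp_top: "norm_Hp (D - 1) = 0"
  using D_ge_2 by (simp add: norm_Hp_eq flip: power_Suc)

lemma norm_minus_0: "minus_coeff 0 * cnj (minus_coeff 0) * norm_H 0 = NN q D e False 0"
  using Q_pow_ne_1[of D] D_ge_2 by (simp add: cnj_minus_coeff NN_eq norm_H_def) (simp add: minus_coeff_def)

text \<open>Each function has one \<open>H\<close> component and at most one \<open>Hp\<close>
  component. Two different ones overlap only for opposite signs with the minus index one above the
  plus index, and \<open>norm_cross\<close> settles that case.\<close>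

theorem ell_orthogonality:
  assumes "i \<le> D - 1" "j \<le> D - 1"
  shows "ipL q D e (ell q D e \<mu> i) (ell q D e \<nu> j) = (if i = j \<and> \<mu> = \<nu> then NN q D e \<mu> i else 0)"
proof -
  \<comment> \<open>The existential form treats the exceptional functions without second component
    together with the regular ones; likewise in \<open>plus\<close>.\<close>
  have minus: "\<exists>b m. node_rep (ell q D e False k) (minus_coeff k) k b m \<and> m \<le> D - 2 \<and>
      (k = 0 \<and> b = 0 \<or> k = Suc m \<and> b = - minus_coeff k * perp_ratio k)" if "k \<le> D - 1" for k
    using that node_rep_minus_0 node_rep_minus[of "k - 1"] by (cases k) auto
  have plus: "\<exists>b m. node_rep (ell q D e True k) (plus_coeff k) (Suc k) b m \<and> m \<le> D - 2 \<and>
      (k = D - 1 \<and> b = 0 \<or> k = m \<and> b = - plus_coeff k)" if "k \<le> D - 1" for k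
  proof (cases "k = D - 1")
    case True
    then show ?thesis using node_rep_plus_top D_ge_2 by auto
  next
    case False
    then have "k \<le> D - 2" using that by simp
    then show ?thesis using node_rep_plus[of k] by auto
  qed
  have le: "i \<le> D" "j \<le> D" "Suc i \<le> D" "Suc j \<le> D"
    using assms D_ge_2 by auto
  obtain bi mi where i_plus: "node_rep (ell q D e True i) (plus_coeff i) (Suc i) bi mi" "mi \<le> D - 2"
      "i = D - 1 \<and> bi = 0 \<or> i = mi \<and> bi = - plus_coeff i"
    using plus[OF assms(1)] by auto
  obtain bj mj where j_plus: "node_rep (ell q D e True j) (plus_coeff j) (Suc j) bj mj" "mj \<le> D - 2"
      "j = D - 1 \<and> bj = 0 \<or> j = mj \<and> bj = - plus_coeff j"
    using plus[OF assms(2)] by auto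
  obtain di ni where i_minus: "node_rep (ell q D e False i) (minus_coeff i) i di ni" "ni \<le> D - 2"
      "i = 0 \<and> di = 0 \<or> i = Suc ni \<and> di = - minus_coeff i * perp_ratio i"
    using minus[OF assms(1)] by auto
  obtain dj nj where j_minus: "node_rep (ell q D e False j) (minus_coeff j) j dj nj" "nj \<le> D - 2"
      "j = 0 \<and> dj = 0 \<or> j = Suc nj \<and> dj = - minus_coeff j * perp_ratio j"
    using minus[OF assms(2)] by auto
  show ?thesis
  proof (cases \<mu>; cases \<nu>)
    assume \<mu> \<nu>
    then have sgn: "\<mu> = True" "\<nu> = True" by auto
    show ?thesis
      unfolding sgn ipL_node_rep[OF i_plus(1) j_plus(1) le(3,4) i_plus(2) j_plus(2)]
      using i_plus(3) j_plus(3) norm_plus[of i] norm_Hp_top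
      by (auto simp: distrib_left)
  next
    assume \<mu> "\<not> \<nu>"
    then have sgn: "\<mu> = True" "\<nu> = False" by auto
    show ?thesis
    proof (cases "j = Suc i")
      case True
      \<comment> \<open>Here \<open>Suc i \<le> D - 1\<close>, so \<open>i\<close> is not the
        exceptional index \<open>D - 1\<close>.\<close>
      with norm_cross[of i] assms have "norm_H (Suc i) + perp_ratio (Suc i) * norm_Hp i = 0" by simp
      then have "plus_coeff i * cnj (minus_coeff j) * (norm_H (Suc i) + perp_ratio (Suc i) * norm_Hp i) = 0" by simp
      then show ?thesis
        unfolding sgn ipL_node_rep[OF i_plus(1) j_minus(1) le(3,2) i_plus(2) j_minus(2)]
        using i_plus(3) j_minus(3) True assms D_ge_2
        by (auto simp: cnj_perp_ratio algebra_simps)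
    next
      case False
      then show ?thesis
        unfolding sgn ipL_node_rep[OF i_plus(1) j_minus(1) le(3,2) i_plus(2) j_minus(2)]
        using i_plus(3) j_minus(3)
        by auto
    qed
  next
    assume "\<not> \<mu>" \<nu>
    then have sgn: "\<mu> = False" "\<nu> = True" by auto
    show ?thesis
    proof (cases "i = Suc j")
      case True
      with norm_cross[of j] assms have "norm_H (Suc j) + perp_ratio (Suc j) * norm_Hp j = 0" by simp
      then have "minus_coeff i * cnj (plus_coeff j) * (norm_H (Suc j) + perp_ratio (Suc j) * norm_Hp j) = 0" by simp
      then show ?thesis
        unfolding sgn ipL_node_rep[OF i_minus(1) j_plus(1) le(1,4) i_minus(2) j_plus(2)]
        using i_minus(3) j_plus(3) True assms D_ge_2
        by (auto simp: cnj_perp_ratio algebra_simps)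
    next
      case False
      then show ?thesis
        unfolding sgn ipL_node_rep[OF i_minus(1) j_plus(1) le(1,4) i_minus(2) j_plus(2)]
        using i_minus(3) j_plus(3)
        by auto
    qed
  next
    assume "\<not> \<mu>" "\<not> \<nu>"
    then have sgn: "\<mu> = False" "\<nu> = False" by auto
    show ?thesis
      unfolding sgn ipL_node_rep[OF i_minus(1) j_minus(1) le(1,2) i_minus(2) j_minus(2)]
      using i_minus(3) j_minus(3) norm_minus[of ni] norm_minus_0 assms
      by (auto simp: cnj_perp_ratio algebra_simps)
  qed
qed

end

theorem theorem10p7:
  fixes q :: nat and D :: nat and e :: real and i j :: nat and \<mu> \<nu> :: bool
  assumes "primepow q"
    and "D \<ge> 3"
    and "e \<in> {0, 1/2, 1, 3/2, 2}"
    and "e \<in> {1/2, 3/2} \<longrightarrow> (\<exists>r::nat. q = r ^ 2)"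
    and "i \<le> D - 1" and "j \<le> D - 1"
  shows "ipL (real q) D e (ell (real q) D e \<mu> i) (ell (real q) D e \<nu> j)
         = (if i = j \<and> \<mu> = \<nu> then NN (real q) D e \<mu> i else 0)"
proof -
  interpret dual_polar_nodes "real q" D e
    using primepow_gt_Suc_0[OF assms(1)] assms(2) by unfold_locales auto
  show ?thesis
    by (rule ell_orthogonality[OF assms(5,6)])
qed

end
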